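(* Let $p$ be a prime and let $F_n$ be a free group of finite rank $n$ with basis $A=\{a_1,\ldots,a_n\}$. Let $w \in F_n \setminus \{1\}$, $u = \mathrm{root}(w)$ and $e = \mathrm{exp}(w)$. Let $d_p = \gcd(e,h_u)\,\nu_p(e)$. Then $\mathrm{Cl}_{\mathbf{V}_p}(\langle w\rangle) = \langle u^{d_p}\rangle$.
   Context: $\mathbf{V}_p$ is the pseudovariety of all finite groups having a normal Sylow $p$-subgroup with quotient an abelian group of exponent dividing $p-1$. For a pseudovariety $\mathbf{V}$ of finite groups, the pro-$\mathbf{V}$ topology on a group $G$ is the coarsest topology making all homomorphisms from $G$ into (discrete) members of $\mathbf{V}$ continuous; equivalently, $G$ is a topological group in which the normal subgroups $K$ with $G/K \in \mathbf{V}$ form a basis of neighbourhoods of the identity. $\mathrm{Cl}_{\mathbf{V}}(S)$ denotes the closure of $S \subseteq F_n$ in the pro-$\mathbf{V}$ topology on $F_n$. For $1 \leq i \leq n$, $f_{a_i}:F_n \to \mathbb{Z}$ is the homomorphism with $f_{a_i}(a_i)=1$ and $f_{a_i}(a_j)=0$ for $j \neq i$. For $v \in F_n$, $h_v = \frac{p-1}{\gcd(p-1,f_{a_1}(v),\ldots,f_{a_n}(v))}$. For $k \geq 1$, $\nu_p(k)$ denotes the largest power of $p$ dividing $k$ (the power itself, not the exponent). For $w \in F_n \setminus\{1\}$, the exponent $\mathrm{exp}(w)$ is the maximum $r \geq 1$ such that $w = v^r$ for some $v \in F_n$, and $\mathrm{root}(w)$ is the (unique) element of $F_n$ with $w = \mathrm{root}(w)^{\mathrm{exp}(w)}$.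 *)

theory Defs
  imports "HOL-Algebra.Algebra" "HOL-Analysis.Abstract_Topology"
begin

section \<open>Free groups\<close>

text \<open>
  A letter \<open>(i, True)\<close> stands for the generator \<open>a i\<close>, and \<open>(i, False)\<close> for its inverse.
\<close>

type_synonym word = "(nat \<times> bool) list"

definition reduced_words :: "nat set \<Rightarrow> word set" where
  "reduced_words I =
     {ws \<in> lists (I \<times> UNIV). successively (\<lambda>(i, s) (j, t). \<not> (i = j \<and> s \<noteq> t)) ws}"

definition word_value :: "('g, 'm) monoid_scheme \<Rightarrow> (nat \<Rightarrow> 'g) \<Rightarrow> word \<Rightarrow> 'g" where
  "word_value G a ws =
     foldr (\<lambda>(i, s) g. (if s then a i else inv\<^bsub>G\<^esub> a i) \<otimes>\<^bsub>G\<^esub> g) ws \<one>\<^bsub>G\<^esub>"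

text \<open>
  \<open>G\<close> is free on the family \<open>(a i)\<close>, \<open>i \<in> I\<close>, if every element of \<open>G\<close> is the value of exactly one
  reduced word. This avoids a quantification over test groups of arbitrary type; the
  universal property is \<open>free_basis_universal\<close> below.
\<close>

definition free_basis :: "('g, 'm) monoid_scheme \<Rightarrow> nat set \<Rightarrow> (nat \<Rightarrow> 'g) \<Rightarrow> bool" where
  "free_basis G I a \<longleftrightarrow>
     group G \<and> a \<in> I \<rightarrow> carrier G \<and> bij_betw (word_value G a) (reduced_words I) (carrier G)"

definition exponent_hom ::
    "('g, 'm) monoid_scheme \<Rightarrow> nat set \<Rightarrow> (nat \<Rightarrow> 'g) \<Rightarrow> nat \<Rightarrow> 'g \<Rightarrow> int" where
  "exponent_hom G I a i =
     (THE f. f \<in> hom G integer_group \<inter> extensional (carrier G) \<and>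
             (\<forall>j\<in>I. f (a j) = (if j = i then 1 else 0)))"

definition group_exp :: "('g, 'm) monoid_scheme \<Rightarrow> 'g \<Rightarrow> nat" where
  "group_exp G w = (GREATEST r. r \<ge> 1 \<and> (\<exists>v\<in>carrier G. w = v [^]\<^bsub>G\<^esub> r))"

definition group_root :: "('g, 'm) monoid_scheme \<Rightarrow> 'g \<Rightarrow> 'g" where
  "group_root G w = (THE v. v \<in> carrier G \<and> w = v [^]\<^bsub>G\<^esub> group_exp G w)"


section \<open>The pseudovariety and its topology\<close>

definition sylow_subgroup :: "nat \<Rightarrow> 'h set \<Rightarrow> ('h, 'm) monoid_scheme \<Rightarrow> bool" where
  "sylow_subgroup p P H \<longleftrightarrow> subgroup P H \<and> card P = p ^ multiplicity p (order H)"

definition pseudovariety_V :: "nat \<Rightarrow> ('h, 'm) monoid_scheme \<Rightarrow> bool" where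
  "pseudovariety_V p H \<longleftrightarrow>
     group H \<and> finite (carrier H) \<and>
     (\<exists>P. P \<lhd> H \<and> sylow_subgroup p P H \<and> comm_group (H Mod P) \<and>
          (\<forall>x\<in>carrier (H Mod P). x [^]\<^bsub>H Mod P\<^esub> (p - 1) = \<one>\<^bsub>H Mod P\<^esub>))"

text \<open>
  The coarsest topology for which every homomorphism from \<open>G\<close> to a discrete member of \<open>V\<close> is
  continuous. Every finite group is isomorphic to one whose carrier consists of natural
  numbers, so for isomorphism-closed classes \<open>V\<close> of finite groups there is no loss in
  considering only members of type \<open>nat monoid\<close>.
\<close>

definition pro_topology :: "(nat monoid \<Rightarrow> bool) \<Rightarrow> ('g, 'm) monoid_scheme \<Rightarrow> 'g topology" where
  "pro_topology V G =
     topology_generated_by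
       {{x \<in> carrier G. h x \<in> S} | H h S.
          V H \<and> h \<in> hom G H \<and> openin (discrete_topology (carrier H)) S}"


section \<open>The numerical invariants\<close>

definition h_inv :: "nat \<Rightarrow> ('g, 'm) monoid_scheme \<Rightarrow> nat set \<Rightarrow> (nat \<Rightarrow> 'g) \<Rightarrow> 'g \<Rightarrow> nat" where
  "h_inv p G I a v =
     (p - 1) div nat (Gcd (insert (int (p - 1)) ((\<lambda>i. exponent_hom G I a i v) ` I)))"

text \<open>The power of \<open>p\<close> itself, not its exponent.\<close>

definition nu :: "nat \<Rightarrow> nat \<Rightarrow> nat" where
  "nu p k = p ^ multiplicity p k"


section \<open>Sanity checks\<close>

fun reduce_word :: "word \<Rightarrow> word" where
  "reduce_word [] = []"
| "reduce_word ((i, s) # ws) =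
     (case reduce_word ws of
        [] \<Rightarrow> [(i, s)]
      | (j, t) # vs \<Rightarrow> if i = j \<and> s \<noteq> t then vs else (i, s) # (j, t) # vs)"

lemma reduce_word_reduced:
  "ws \<in> lists (I \<times> UNIV) \<Longrightarrow> reduce_word ws \<in> reduced_words I"
  by (induction ws rule: reduce_word.induct)
     (auto simp: reduced_words_def successively_Cons split: list.splits)

lemma word_value_simps [simp]:
  "word_value G a [] = \<one>\<^bsub>G\<^esub>"
  "word_value G a ((i, s) # ws) = (if s then a i else inv\<^bsub>G\<^esub> a i) \<otimes>\<^bsub>G\<^esub> word_value G a ws"
  by (simp_all add: word_value_def)

lemma (in group) word_value_closed:
  "a \<in> I \<rightarrow> carrier G \<Longrightarrow> ws \<in> lists (I \<times> UNIV) \<Longrightarrow> word_value G a ws \<in> carrier G"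
  by (induction ws) (auto simp: Pi_iff)

lemma (in group) word_value_append:
  "a \<in> I \<rightarrow> carrier G \<Longrightarrow> ws \<in> lists (I \<times> UNIV) \<Longrightarrow> vs \<in> lists (I \<times> UNIV) \<Longrightarrow>
     word_value G a (ws @ vs) = word_value G a ws \<otimes> word_value G a vs"
proof (induction ws)
  case Nil
  then show ?case using word_value_closed[of a I vs] by simp
next
  case (Cons x ws)
  then show ?case
    using word_value_closed[of a I ws] word_value_closed[of a I vs]
    by (cases x) (auto simp: m_assoc Pi_iff)
qed

lemma (in group) word_value_reduce:
  assumes a: "a \<in> I \<rightarrow> carrier G"
  shows "ws \<in> lists (I \<times> UNIV) \<Longrightarrow> word_value G a (reduce_word ws) = word_value G a ws"
proof (induction ws rule: reduce_word.induct)
  case (2 i s ws)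
  have ai: "a i \<in> carrier G" using 2 a by auto
  have IH: "word_value G a (reduce_word ws) = word_value G a ws" using 2 by auto
  have r: "reduce_word ws \<in> lists (I \<times> UNIV)"
    using 2 reduce_word_reduced[of ws I] by (auto simp: reduced_words_def)
  show ?case
  proof (cases "reduce_word ws")
    case Nil
    then show ?thesis using IH by simp
  next
    case (Cons x vs)
    obtain j t where x: "x = (j, t)" by (cases x)
    have vs: "word_value G a vs \<in> carrier G" and aj: "a j \<in> carrier G"
      using r Cons x a by (auto intro!: word_value_closed[OF a])
    have "word_value G a ws = (if t then a j else inv a j) \<otimes> word_value G a vs"
      using IH by (simp add: Cons x)
    then show ?thesis
      using ai aj vs by (auto simp: Cons x m_assoc[symmetric])
  qed
qed simp

theorem free_basis_universal:
  fixes G :: "('g, 'm) monoid_scheme" and H :: "('h, 'k) monoid_scheme"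
  assumes "free_basis G I a" and "group H" and b: "b \<in> I \<rightarrow> carrier H"
  shows "\<exists>!f. f \<in> hom G H \<inter> extensional (carrier G) \<and> (\<forall>i\<in>I. f (a i) = b i)"
proof -
  interpret G: group G using assms(1) by (simp add: free_basis_def)
  interpret H: group H by fact
  have a: "a \<in> I \<rightarrow> carrier G" and bij: "bij_betw (word_value G a) (reduced_words I) (carrier G)"
    using assms(1) by (auto simp: free_basis_def)
  let ?W = "lists (I \<times> (UNIV :: bool set))"
  have rep: "\<exists>ws\<in>?W. word_value G a ws = g" if "g \<in> carrier G" for g
  proof -
    have "g \<in> word_value G a ` reduced_words I" using that bij by (simp add: bij_betw_def)
    then show ?thesis by (auto simp: reduced_words_def)
  qed
  have wd: "word_value H b ws = word_value H b vs"
    if "ws \<in> ?W" "vs \<in> ?W" "word_value G a ws = word_value G a vs" for ws vs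
  proof -
    have ws: "reduce_word ws \<in> reduced_words I" "word_value G a (reduce_word ws) = word_value G a ws"
        "word_value H b (reduce_word ws) = word_value H b ws"
      using that(1) reduce_word_reduced G.word_value_reduce[OF a] H.word_value_reduce[OF b] by simp_all
    have vs: "reduce_word vs \<in> reduced_words I" "word_value G a (reduce_word vs) = word_value G a vs"
        "word_value H b (reduce_word vs) = word_value H b vs"
      using that(2) reduce_word_reduced G.word_value_reduce[OF a] H.word_value_reduce[OF b] by simp_all
    have "reduce_word ws = reduce_word vs"
      using inj_onD[OF bij_betw_imp_inj_on[OF bij] _ ws(1) vs(1)] ws(2) vs(2) that(3) by simp
    then show ?thesis using ws(3) vs(3) by simp
  qed
  define r where "r g = (SOME ws. ws \<in> ?W \<and> word_value G a ws = g)" for g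
  have r: "r g \<in> ?W \<and> word_value G a (r g) = g" if "g \<in> carrier G" for g
    using someI_ex[OF rep[OF that, unfolded Bex_def]] by (simp only: r_def)
  define f where "f = restrict (\<lambda>g. word_value H b (r g)) (carrier G)"
  have f: "f (word_value G a ws) = word_value H b ws" if "ws \<in> ?W" for ws
  proof -
    have g: "word_value G a ws \<in> carrier G" by (rule G.word_value_closed[OF a that])
    have "word_value H b (r (word_value G a ws)) = word_value H b ws"
      using r[OF g] that by (intro wd) blast+
    then show ?thesis using g by (simp add: f_def)
  qed
  have hom: "f \<in> hom G H"
  proof (rule homI)
    show "f x \<in> carrier H" if x: "x \<in> carrier G" for x
    proof -
      obtain ws where "ws \<in> ?W" "x = word_value G a ws" using rep[OF x] by blast
      then show ?thesis by (simp only: f H.word_value_closed[OF b])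
    qed
    show "f (x \<otimes>\<^bsub>G\<^esub> y) = f x \<otimes>\<^bsub>H\<^esub> f y" if xy: "x \<in> carrier G" "y \<in> carrier G" for x y
    proof -
      obtain ws vs where w: "ws \<in> ?W" "vs \<in> ?W" "x = word_value G a ws" "y = word_value G a vs"
        using rep[OF xy(1)] rep[OF xy(2)] by blast
      have wv: "ws @ vs \<in> ?W" using w by auto
      have "f (x \<otimes>\<^bsub>G\<^esub> y) = f (word_value G a (ws @ vs))"
        by (simp only: w(3,4) G.word_value_append[OF a w(1,2)])
      also have "\<dots> = word_value H b ws \<otimes>\<^bsub>H\<^esub> word_value H b vs"
        by (simp only: f[OF wv] H.word_value_append[OF b w(1,2)])
      finally show ?thesis by (simp only: w(3,4) f[OF w(1)] f[OF w(2)])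
    qed
  qed
  have base: "f (a i) = b i" if "i \<in> I" for i
    using f[of "[(i, True)]"] that a b by (simp add: Pi_iff)
  have uniq: "g = f"
    if g: "g \<in> hom G H" "g \<in> extensional (carrier G)" "\<forall>i\<in>I. g (a i) = b i" for g
  proof -
    interpret gh: group_hom G H g
      using g by (simp add: group_hom_def group_hom_axioms_def)
    have "g (word_value G a ws) = word_value H b ws" if "ws \<in> ?W" for ws
      using that
    proof (induction ws)
      case (Cons x ws)
      then show ?case
        using g a G.word_value_closed[OF a, of ws] by (cases x) (auto simp: Pi_iff)
    qed simp
    then have "g x = f x" if x: "x \<in> carrier G" for x
    proof -
      obtain ws where "ws \<in> ?W" "x = word_value G a ws" using rep[OF x] by blast
      then show ?thesis using \<open>\<And>ws. ws \<in> ?W \<Longrightarrow> g (word_value G a ws) = word_value H b ws\<close>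
        by (simp only: f)
    qed
    then show ?thesis
      using g by (intro extensionalityI[of _ "carrier G"]) (auto simp: f_def)
  qed
  have ext: "f \<in> extensional (carrier G)" by (simp add: f_def)
  show ?thesis
    by (rule ex1I[of _ f]) (use hom base ext in blast, use uniq in blast)
qed

corollary exponent_hom:
  assumes "free_basis G I a"
  shows "exponent_hom G I a i \<in> hom G integer_group"
    and "j \<in> I \<Longrightarrow> exponent_hom G I a i (a j) = (if j = i then 1 else 0)"
proof -
  have "exponent_hom G I a i \<in> hom G integer_group \<inter> extensional (carrier G) \<and>
          (\<forall>j\<in>I. exponent_hom G I a i (a j) = (if j = i then 1 else 0))"
    unfolding exponent_hom_def
    by (rule theI'[OF free_basis_universal[OF assms group_integer_group]]) simp
  then show "exponent_hom G I a i \<in> hom G integer_group"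
    and "j \<in> I \<Longrightarrow> exponent_hom G I a i (a j) = (if j = i then 1 else 0)"
    by blast+
qed

end

theory Submission
  imports Defs "HOL-Library.Countable"
begin

text \<open>
  In a group of \<open>\<^bold>V\<^sub>p\<close> the image of \<open>u\<close> has order dividing \<open>h\<^sub>u p\<^sup>k\<close> for some \<open>k\<close>: modulo the
  normal Sylow subgroup it is the product of the \<open>f\<^sub>i(u)\<close>-th powers of elements of order dividing
  \<open>p - 1\<close>. As \<open>gcd(e, h\<^sub>u p\<^sup>k)\<close> divides \<open>d\<close>, the powers of \<open>u\<^sup>d\<close> lie in the closure.

  Conversely, free groups are residually \<open>p\<close>, so a point of the closure commutes with \<open>w\<close> and is
  therefore a power \<open>u\<^sup>j\<close>, because centralizers in free groups are cyclic. A cyclic quotient of order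
  \<open>p - 1\<close>, built from Bezout coefficients for the \<open>f\<^sub>i(u)\<close>, shows that \<open>gcd(e, h\<^sub>u)\<close> divides \<open>j\<close>, and a
  finite \<open>p\<close>-quotient in which \<open>u\<close> has large order shows that \<open>\<nu>\<^sub>p(e)\<close> does.

  Residual finiteness comes from playing ping-pong with conjugates of \<open>(1 m; 0 1)\<close> in the principal
  congruence subgroup \<open>\<Gamma>(p)\<close> of \<open>SL\<^sub>2(\<int>)\<close>, whose quotients \<open>\<Gamma>(p)/\<Gamma>(p\<^sup>k)\<close> are finite \<open>p\<close>-groups.
\<close>

section \<open>Centralizers in free groups\<close>

definition compatible :: "nat \<times> bool \<Rightarrow> nat \<times> bool \<Rightarrow> bool" where
  "compatible x y \<longleftrightarrow> fst x = fst y \<longrightarrow> snd x = snd y"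

lemma reduced_words_eq: "reduced_words I = {ws \<in> lists (I \<times> UNIV). successively compatible ws}"
proof -
  have "compatible = (\<lambda>(i, s) (j, t). \<not> (i = j \<and> s \<noteq> t))"
    by (auto simp: compatible_def fun_eq_iff)
  then show ?thesis by (simp only: reduced_words_def)
qed

abbreviation flip :: "nat \<times> bool \<Rightarrow> nat \<times> bool" where
  "flip x \<equiv> (fst x, \<not> snd x)"

lemma not_compatible_iff: "\<not> compatible x y \<longleftrightarrow> y = flip x"
  by (cases x; cases y) (auto simp: compatible_def)

lemma Nil_reduced [simp]: "[] \<in> reduced_words I"
  by (simp add: reduced_words_def)

lemma reduced_words_append:
  "xs @ ys \<in> reduced_words I \<longleftrightarrow>
     xs \<in> reduced_words I \<and> ys \<in> reduced_words I \<and>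
     (xs = [] \<or> ys = [] \<or> compatible (last xs) (hd ys))"
  by (auto simp: reduced_words_eq successively_append_iff)

lemma reduced_words_ConsI:
  "x # xs \<in> reduced_words I \<Longrightarrow> xs \<in> reduced_words I"
  using reduced_words_append[of "[x]" xs I] by simp

lemma reduced_words_lists: "xs \<in> reduced_words I \<Longrightarrow> xs \<in> lists (I \<times> UNIV)"
  by (simp add: reduced_words_def)

text \<open>The hypothesis says that \<open>c\<close> is cyclically reduced: every junction in a
  power of \<open>c\<close> already occurs in \<open>c @ c\<close>.\<close>

lemma concat_replicate_reduced:
  assumes "c @ c \<in> reduced_words I"
  shows "concat (replicate k c) \<in> reduced_words I"
proof (induction k)
  case 0
  then show ?case by (simp add: reduced_words_def)
next
  case (Suc k)
  show ?case
  proof (cases "c = [] \<or> k = 0")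
    case True
    moreover have "c \<in> reduced_words I" "[] \<in> reduced_words I"
      using assms by (simp_all add: reduced_words_append)
    ultimately show ?thesis by auto
  next
    case False
    then obtain l where "k = Suc l" by (cases k) auto
    then have "hd (concat (replicate k c)) = hd c" using False by simp
    then show ?thesis using Suc assms by (auto simp: reduced_words_append)
  qed
qed

text \<open>The words commuting with \<open>c\<close> are prefixes of powers of \<open>c\<close>, so a shortest nonempty one is a
  prefix of every other.\<close>

lemma commuting_words:
  fixes c :: "'a list"
  assumes "c \<noteq> []"
  obtains z where "z \<noteq> []" "\<And>y. y @ c = c @ y \<Longrightarrow> \<exists>k. y = concat (replicate k z)"
proof -
  define P where "P y \<longleftrightarrow> y \<noteq> [] \<and> y @ c = c @ y" for y
  have "P c" using assms by (simp add: P_def)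
  define z where "z = arg_min length P"
  have z: "P z" "\<And>y. P y \<Longrightarrow> length z \<le> length y"
    using arg_min_natI[of P c length] arg_min_nat_le[of P _ length] \<open>P c\<close> by (auto simp: z_def)
  \<comment> \<open>\<open>y\<close> commutes with the \<open>k\<close>-th power of
    \<open>c\<close>, which is at least as long as \<open>y\<close> because \<open>c\<close> is
    nonempty; comparing the two products shows that \<open>y\<close> is a prefix.\<close>
  have pre: "\<exists>r. concat (replicate k c) = y @ r"
    if "y @ c = c @ y" and "length y \<le> k" for y k
  proof -
    have com: "y @ concat (replicate l c) = concat (replicate l c) @ y" for l
    proof (induction l)
      case (Suc l)
      have "y @ c @ concat (replicate l c) = c @ y @ concat (replicate l c)"
        using that(1) by (metis append.assoc)
      then show ?case using Suc by simp
    qed simp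
    have "length y \<le> length (concat (replicate k c))"
    proof -
      have "k \<le> k * length c" using assms by (cases c) auto
      then have "length y \<le> k * length c" using that(2) by (rule le_trans[rotated])
      then show ?thesis by (simp add: length_concat sum_list_replicate)
    qed
    then show ?thesis
      using com[of k] by (metis append_eq_append_conv_if append_take_drop_id)
  qed
  have "\<exists>k. y = concat (replicate k z)" if "y @ c = c @ y" for y
    using that
  proof (induction y rule: length_induct)
    case (1 y)
    show ?case
    proof (cases "y = []")
      case True
      then show ?thesis by (intro exI[of _ 0]) simp
    next
      case False
      then have le: "length z \<le> length y" using z(2) 1 by (simp add: P_def)
      obtain r r' where "concat (replicate (length y) c) = y @ r"
          "concat (replicate (length y) c) = z @ r'"
        using pre[of y "length y"] pre[of z "length y"] 1 z(1) le by (auto simp: P_def)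
      then have "y @ r = z @ r'" by simp
      then obtain y2 where y2: "y = z @ y2"
        using le by (metis append_eq_append_conv_if append_take_drop_id)
      have "z @ y2 @ c = z @ c @ y2"
        using 1(2) z(1) by (simp add: y2 P_def flip: append_assoc)
      then have "y2 @ c = c @ y2" by simp
      moreover have "length y2 < length y" using z(1) by (simp add: y2 P_def)
      ultimately obtain k where "y2 = concat (replicate k z)" using 1(1) by blast
      then show ?thesis by (intro exI[of _ "Suc k"]) (simp add: y2)
    qed
  qed
  then show ?thesis using that z(1) by (auto simp: P_def)
qed

section \<open>Values of words, cancellation and centralizers\<close>

locale free_group = group F for F (structure) +
  fixes I :: "nat set" and a :: "nat \<Rightarrow> 'a"
  assumes free: "free_basis F I a"
begin

abbreviation val :: "word \<Rightarrow> 'a" where "val \<equiv> word_value F a"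

lemma basis_closed: "a \<in> I \<rightarrow> carrier F"
  and val_bij: "bij_betw val (reduced_words I) (carrier F)"
  using free by (auto simp: free_basis_def)

lemma val_closed: "ws \<in> lists (I \<times> UNIV) \<Longrightarrow> val ws \<in> carrier F"
  by (rule word_value_closed[OF basis_closed])

lemma val_append:
  "ws \<in> lists (I \<times> UNIV) \<Longrightarrow> vs \<in> lists (I \<times> UNIV) \<Longrightarrow> val (ws @ vs) = val ws \<otimes> val vs"
  by (rule word_value_append[OF basis_closed])

lemma val_inj: "ws \<in> reduced_words I \<Longrightarrow> vs \<in> reduced_words I \<Longrightarrow> val ws = val vs \<Longrightarrow> ws = vs"
  using val_bij by (auto simp: bij_betw_def dest: inj_onD)

lemma obtain_word:
  assumes "g \<in> carrier F"
  obtains ws where "ws \<in> reduced_words I" "val ws = g"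
  using assms val_bij unfolding bij_betw_def by (metis imageE)

lemma val_flip:
  assumes "x \<in> I \<times> UNIV"
  shows "val [x] \<otimes> val [flip x] = \<one>"
  using assms basis_closed by (auto simp: Pi_iff)

lemma val_concat_replicate:
  assumes "ws \<in> lists (I \<times> UNIV)"
  shows "val (concat (replicate k ws)) = val ws [^] k"
proof (induction k)
  case (Suc k)
  have "concat (replicate k ws) \<in> lists (I \<times> UNIV)" using assms by (induction k) auto
  then show ?case using Suc assms val_closed[OF assms] by (simp add: val_append nat_pow_Suc2[symmetric] del: nat_pow_Suc)
qed simp

text \<open>Letters cancel in pairs at the junction of \<open>r\<close> and \<open>v\<close>:
  \<open>v0\<close> is the part of \<open>v\<close> that is lost and \<open>r'\<close> is what
  remains of \<open>r\<close>. The length of \<open>r'\<close>, and \<open>r' = r\<close> when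
  nothing cancels, are all that \<open>commuting_word\<close> needs to know about it.\<close>

lemma val_append_cancel:
  assumes "r \<in> reduced_words I" "v \<in> reduced_words I"
  obtains r' v0 v' where "v = v0 @ v'" "length r = length r' + length v0"
    "r' @ v' \<in> reduced_words I" "val (r' @ v') = val r \<otimes> val v"
    "v0 = [] \<longrightarrow> r' = r"
proof -
  have "\<exists>r' v0 v'. v = v0 @ v' \<and> length r = length r' + length v0 \<and>
      r' @ v' \<in> reduced_words I \<and> val (r' @ v') = val r \<otimes> val v \<and> (v0 = [] \<longrightarrow> r' = r)"
    using assms
  proof (induction r arbitrary: v rule: rev_induct)
    case Nil
    have "val ([] @ v) = val [] \<otimes> val v"
      by (rule val_append) (use Nil reduced_words_lists in auto)
    then show ?case using Nil by (intro exI[of _ "[]"] exI[of _ v]) simp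
  next
    case (snoc y r)
    show ?case
    proof (cases "(r @ [y]) @ v \<in> reduced_words I")
      case True
      then have "val ((r @ [y]) @ v) = val (r @ [y]) \<otimes> val v"
        by (intro val_append reduced_words_lists) (use snoc in auto)
      then show ?thesis using True
        by (intro exI[of _ "r @ [y]"] exI[of _ "[]"] exI[of _ v]) auto
    next
      case False
      then have "v \<noteq> []" "\<not> compatible y (hd v)"
        using snoc.prems unfolding reduced_words_append by auto
      then obtain v1 where v: "v = flip y # v1" by (cases v) (auto simp: not_compatible_iff)
      have r: "r \<in> reduced_words I" and v1: "v1 \<in> reduced_words I"
        using snoc.prems reduced_words_append[of r "[y]" I] reduced_words_ConsI v by auto
      have y: "y \<in> I \<times> UNIV" using snoc.prems(1) reduced_words_lists by fastforce
      then have y': "[y] \<in> lists (I \<times> UNIV)" "[flip y] \<in> lists (I \<times> UNIV)" by auto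
      have l: "r \<in> lists (I \<times> UNIV)" "v1 \<in> lists (I \<times> UNIV)"
        using r v1 reduced_words_lists by auto
      note cl = val_closed[OF y'(1)] val_closed[OF y'(2)] val_closed[OF l(1)] val_closed[OF l(2)]
      have "val (r @ [y]) \<otimes> val v = (val r \<otimes> val [y]) \<otimes> (val [flip y] \<otimes> val v1)"
        using val_append[OF l(1) y'(1)] val_append[OF y'(2) l(2)] by (simp only: v append_Cons append_Nil)
      also have "\<dots> = val r \<otimes> ((val [y] \<otimes> val [flip y]) \<otimes> val v1)"
        using cl by (simp only: m_assoc m_closed)
      also have "\<dots> = val r \<otimes> val v1" using val_flip[OF y] cl by (simp only: l_one)
      finally have eq: "val (r @ [y]) \<otimes> val v = val r \<otimes> val v1" .
      obtain r' v0 v' where *: "v1 = v0 @ v'" "length r = length r' + length v0"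
          "r' @ v' \<in> reduced_words I" "val (r' @ v') = val r \<otimes> val v1"
        using snoc.IH[OF r v1] by blast
      show ?thesis
        by (rule exI[of _ r'], rule exI[of _ "flip y # v0"], rule exI[of _ v'])
          (use * v eq in simp)
    qed
  qed
  then show ?thesis using that by blast
qed

text \<open>If a reduced word is not cyclically reduced, its first letter is the inverse of its
  last; stripping both is a conjugation and shortens the word.\<close>

lemma cyclic_reduction:
  assumes "g \<in> carrier F"
  obtains h c where "h \<in> carrier F" "c @ c \<in> reduced_words I" "g = h \<otimes> val c \<otimes> inv h"
proof -
  have "\<exists>h c. h \<in> carrier F \<and> c @ c \<in> reduced_words I \<and> val ws = h \<otimes> val c \<otimes> inv h"
    if "ws \<in> reduced_words I" for ws
    using that
  proof (induction ws rule: length_induct)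
    case (1 ws)
    note ws = reduced_words_lists[OF 1(2)]
    show ?case
    proof (cases "ws @ ws \<in> reduced_words I")
      case True
      then show ?thesis using val_closed[OF ws] by (intro exI[of _ \<one>] exI[of _ ws]) simp
    next
      case False
      then have ne: "ws \<noteq> []" and f: "hd ws = flip (last ws)"
        using 1(2) not_compatible_iff by (auto simp: reduced_words_append)
      obtain y vs where wy: "ws = vs @ [y]" using ne by (metis rev_exhaust)
      \<comment> \<open>A letter is not its own inverse, so \<open>ws\<close> has at least two
        letters.\<close>
      have "vs \<noteq> []" using f wy by (cases y) auto
      then obtain mid where vs: "vs = flip y # mid" using f wy by (cases vs) auto
      have eq: "ws = [flip y] @ (mid @ [y])" using wy vs by simp
      have mid: "mid \<in> reduced_words I" and y: "y \<in> I \<times> UNIV"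
        using 1(2) unfolding eq reduced_words_append by (auto dest: reduced_words_lists)
      then obtain h c where hc: "h \<in> carrier F" "c @ c \<in> reduced_words I"
          "val mid = h \<otimes> val c \<otimes> inv h"
        using 1(1)[rule_format, of mid] mid eq by auto
      have c: "val c \<in> carrier F"
        using hc(2) by (intro val_closed[OF reduced_words_lists]) (simp add: reduced_words_append)
      have y': "[y] \<in> lists (I \<times> UNIV)" "[flip y] \<in> lists (I \<times> UNIV)" using y by auto
      note cl = val_closed[OF y'(1)] val_closed[OF y'(2)]
      have inv: "val [y] = inv (val [flip y])"
        using inv_equality[OF val_flip[OF y]] cl by simp
      have "val ws = val [flip y] \<otimes> (val mid \<otimes> val [y])"
        unfolding eq using val_append[OF y'(2), of "mid @ [y]"] val_append[of mid "[y]"]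
          y' reduced_words_lists[OF mid] by (metis append_in_lists_conv)
      also have "\<dots> = (val [flip y] \<otimes> h) \<otimes> val c \<otimes> inv (val [flip y] \<otimes> h)"
        using hc(1) c cl by (simp only: hc(3) inv inv_mult_group m_assoc m_closed inv_closed)
      finally show ?thesis using hc cl by blast
    qed
  qed
  then show ?thesis using obtain_word[OF assms] that by metis
qed

text \<open>Multiplying \<open>x\<close> by a high power of \<open>c\<close> makes the reduced word
  \<open>y\<close> of the product end in an entire copy of \<open>c\<close>, so \<open>y @ c\<close>
  is reduced. As the elements commute, it is also the reduced word of
  \<open>val c \<otimes> val y\<close>; by length nothing cancels in that product, so the words
  commute too.\<close>

lemma commuting_word:
  assumes c: "c \<noteq> []" "c @ c \<in> reduced_words I" and x: "x \<in> carrier F"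
    and com: "x \<otimes> val c = val c \<otimes> x"
  obtains y k where "y \<in> reduced_words I" "y @ c = c @ y" "val y = x \<otimes> val c [^] (k::nat)"
proof -
  have cr: "c \<in> reduced_words I" using c by (simp add: reduced_words_append)
  note cl = reduced_words_lists[OF cr] and cc = val_closed[OF reduced_words_lists[OF cr]]
  obtain r where r: "r \<in> reduced_words I" "val r = x" using obtain_word[OF x] .
  \<comment> \<open>At most \<open>length r\<close> letters of the power cancel, and they lie in the
    first \<open>length r\<close> copies of the nonempty word \<open>c\<close>; the extra copy
    survives.\<close>
  define k where "k = Suc (length r)"
  have v: "concat (replicate k c) = concat (replicate (length r) c) @ c"

    unfolding k_def replicate_Suc replicate_append_same[symmetric] by simp
  have "length r \<le> length r * length c" using c(1) by (cases c) auto
  then have len: "length r \<le> length (concat (replicate (length r) c))"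
    by (simp add: length_concat sum_list_replicate)
  obtain r' v0 v' where *: "concat (replicate k c) = v0 @ v'" "length r = length r' + length v0"
      "r' @ v' \<in> reduced_words I" "val (r' @ v') = x \<otimes> val (concat (replicate k c))"
    using val_append_cancel[OF r(1) concat_replicate_reduced[OF c(2)], of k] r(2) by metis
  have "length v0 \<le> length (concat (replicate (length r) c))" using *(2) len by simp
  then obtain v1 where v1: "v' = v1 @ c"
    using *(1) unfolding v by (auto simp: append_eq_append_conv2)
  define y where "y = (r' @ v1) @ c"
  have y: "y \<in> reduced_words I" "val y = x \<otimes> val c [^] k"
    using *(3,4) val_concat_replicate[OF cl] by (simp_all add: y_def v1)
  note yl = reduced_words_lists[OF y(1)]
  have yc: "y @ c \<in> reduced_words I"
    using y(1) c by (simp add: reduced_words_append[of y c] reduced_words_append[of c c] cr) (simp add: y_def)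
  have "val c \<otimes> val y = val c \<otimes> x \<otimes> val c [^] k" using y x cc by (simp add: m_assoc)
  also have "\<dots> = x \<otimes> (val c \<otimes> val c [^] k)" using com x cc by (simp add: m_assoc[symmetric])
  also have "val c \<otimes> val c [^] k = val c [^] k \<otimes> val c" using nat_pow_Suc2[OF cc, of k] by simp
  also have "x \<otimes> (val c [^] k \<otimes> val c) = val y \<otimes> val c" using y(2) x cc by (simp add: m_assoc)
  finally have vc: "val c \<otimes> val y = val (y @ c)" using val_append[OF yl cl] by simp
  obtain c' y0 y' where **: "y = y0 @ y'" "length c = length c' + length y0"
      "c' @ y' \<in> reduced_words I" "val (c' @ y') = val c \<otimes> val y" "y0 = [] \<longrightarrow> c' = c"
    using val_append_cancel[OF cr y(1)] by metis
  \<comment> \<open>Each letter of \<open>y0\<close> shortens the product by two, but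
    \<open>y @ c\<close> has full length.\<close>
  have eq: "c' @ y' = y @ c" using val_inj[OF **(3) yc] **(4) vc by simp
  then have "length (c' @ y') = length (y @ c)" by simp
  then have "y0 = []" using **(1,2) by simp
  then have "c' = c" "y' = y" using **(1,5) by simp_all
  then have "y @ c = c @ y" using eq by metis
  then show ?thesis using that y by blast
qed

lemma nontrivial_power:
  assumes "c \<noteq> []" "c @ c \<in> reduced_words I" "val c [^] (j::nat) = \<one>"
  shows "j = 0"
proof -
  have "c \<in> lists (I \<times> UNIV)"
    using assms(2) by (intro reduced_words_lists) (simp add: reduced_words_append)
  then have "val (concat (replicate j c)) = val []" using assms val_concat_replicate by simp
  then have "concat (replicate j c) = []"
    using concat_replicate_reduced[OF assms(2)] by (intro val_inj) (auto simp: reduced_words_def)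
  then show ?thesis using assms(1) by simp
qed

text \<open>Infinite order passes from \<open>w\<close> to \<open>z\<close>: a relation
  \<open>z [^] k = \<one>\<close> gives \<open>w [^] k = \<one>\<close>.\<close>

lemma pow_eq_int_pow_imp:
  assumes "z \<in> carrier F" "z [^] (m::nat) = w" "\<And>j::nat. w [^] j = \<one> \<Longrightarrow> j = 0"
    and eq: "z [^] (i::int) = z [^] (j::int)"
  shows "i = j"
proof -
  have *: "i \<le> j" if ij: "z [^] (i::int) = z [^] (j::int)" for i j
  proof (rule ccontr)
    assume "\<not> i \<le> j"
    then obtain k :: nat where k: "k > 0" "i = j + int k"
      using that[of "nat (i - j)"] by simp
    have "z [^] j \<otimes> z [^] k = z [^] j"
      using ij assms(1) by (simp add: k(2) int_pow_mult int_pow_int)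
    then have "z [^] k = \<one>" using assms(1) by (simp only: l_cancel_one nat_pow_closed int_pow_closed)
    then have "(z [^] k) [^] m = \<one>" by simp
    then have "w [^] k = \<one>"
      using assms(1,2) by (simp add: nat_pow_pow mult.commute flip: assms(2))
    then show False using assms(3)[of k] k(1) by simp
  qed
  show ?thesis using *[of i j] *[of j i] eq by simp
qed

text \<open>Up to conjugation, \<open>w\<close> is the value of a cyclically reduced word
  \<open>c\<close>. Elements commuting with \<open>val c\<close> are, up to powers of
  \<open>val c\<close>, values of words commuting with \<open>c\<close>, and these words are powers
  of a single word \<open>t\<close>.\<close>

theorem centralizer_cyclic:
  assumes w: "w \<in> carrier F" "w \<noteq> \<one>"
  obtains z and m :: nat where "z \<in> carrier F" "m \<ge> 1" "w = z [^] m"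
    "\<And>x. x \<in> carrier F \<Longrightarrow> x \<otimes> w = w \<otimes> x \<Longrightarrow> \<exists>l::int. x = z [^] l"
    "\<And>i j::int. z [^] i = z [^] j \<Longrightarrow> i = j"
proof -
  obtain h c where h: "h \<in> carrier F" and cc: "c @ c \<in> reduced_words I"
      and wc: "w = h \<otimes> val c \<otimes> inv h"
    using cyclic_reduction[OF w(1)] .
  have cr: "c \<in> reduced_words I" using cc by (simp add: reduced_words_append)
  note cl = reduced_words_lists[OF cr]
  have vc: "val c \<in> carrier F" using val_closed[OF cl] .
  have c: "c \<noteq> []" using w(2) wc h by auto
  obtain t where t: "t \<noteq> []" "\<And>y. y @ c = c @ y \<Longrightarrow> \<exists>k. y = concat (replicate k t)"
    using commuting_words[OF c] by blast
  obtain m where m: "c = concat (replicate m t)" using t(2)[of c] by blast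
  then have m1: "m \<ge> 1" using c by (cases m) auto
  have tl: "t \<in> lists (I \<times> UNIV)" using cl m m1 by (cases m) auto
  define z where "z = val t"
  have z: "z \<in> carrier F" using val_closed[OF tl] by (simp add: z_def)
  have pow: "val (concat (replicate k t)) = z [^] k" for k
    using val_concat_replicate[OF tl] by (simp add: z_def)
  have cz: "val c = z [^] m" using pow m by metis
  have cent: "\<exists>l::int. x = z [^] l" if x: "x \<in> carrier F" "x \<otimes> val c = val c \<otimes> x" for x
  proof -
    obtain y k where y: "y @ c = c @ y" "val y = x \<otimes> val c [^] (k::nat)"
      using commuting_word[OF c cc x] by metis
    obtain l where "y = concat (replicate l t)" using t(2)[OF y(1)] by blast
    then have "x \<otimes> z [^] (m * k) = z [^] l" using y(2) pow cz z by (simp add: nat_pow_pow)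
    then have "x \<otimes> z [^] (int (m * k)) = z [^] (int l)" by (simp only: int_pow_int)
    then have "x = z [^] (int l) \<otimes> inv (z [^] (int (m * k)))"
      using x(1) z by (simp add: inv_solve_right)
    also have "\<dots> = z [^] (int l - int (m * k))" using z by (simp add: int_pow_diff)
    finally show ?thesis by blast
  qed
  have inj: "i = j" if "z [^] (i::int) = z [^] (j::int)" for i j
    using pow_eq_int_pow_imp[OF z cz[symmetric] nontrivial_power[OF c cc] that] .
  \<comment> \<open>Conjugation by \<open>h\<close> is an injective endomorphism, which carries the
    result for \<open>val c\<close> over to \<open>w\<close>.\<close>
  let ?g = "\<lambda>x. h \<otimes> x \<otimes> inv h"
  have hh: "inv h \<otimes> (h \<otimes> t) = t" "h \<otimes> (inv h \<otimes> t) = t" if "t \<in> carrier F" for t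
    using h that by (simp_all flip: m_assoc)
  have conj: "?g \<in> hom F F"
    using h by (intro homI) (simp_all add: m_assoc hh)
  interpret g: group_hom F F ?g using conj by unfold_locales
  have cancel: "?g x = ?g y \<longleftrightarrow> x = y" if "x \<in> carrier F" "y \<in> carrier F" for x y
    using that h by simp
  have "w = ?g z [^] m"
    using g.hom_nat_pow[OF z] by (simp add: wc cz)
  moreover have "\<exists>l::int. x = ?g z [^] l" if x: "x \<in> carrier F" "x \<otimes> w = w \<otimes> x" for x
  proof -
    define x' where "x' = inv h \<otimes> x \<otimes> h"
    have x': "x' \<in> carrier F" and xx: "x = ?g x'"
      using x h by (simp_all add: x'_def m_assoc hh)
    have "?g (x' \<otimes> val c) = ?g (val c \<otimes> x')"
      using x(2) g.hom_mult[OF x' vc] g.hom_mult[OF vc x'] by (simp only: xx wc)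
    then have "x' \<otimes> val c = val c \<otimes> x'"
      by (subst (asm) cancel) (simp_all add: x' vc)
    then obtain l :: int where "x' = z [^] l" using cent x' by blast
    then show ?thesis using g.hom_int_pow[OF z] xx by auto
  qed
  moreover have "i = j" if "?g z [^] (i::int) = ?g z [^] (j::int)" for i j
  proof -
    have "?g (z [^] i) = ?g (z [^] j)" using that g.hom_int_pow[OF z] by simp
    then show ?thesis using cancel z inj by simp
  qed
  ultimately show ?thesis using that[of "?g z" m] z h m1 by blast
qed

end

section \<open>Ping-pong in \<open>SL\<^sub>2(\<int>)\<close>\<close>

type_synonym matrix2 = "int \<times> int \<times> int \<times> int"

fun mat_mult :: "matrix2 \<Rightarrow> matrix2 \<Rightarrow> matrix2" where
  "mat_mult (x, y, z, w) (x', y', z', w') =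
     (x * x' + y * z', x * y' + y * w', z * x' + w * z', z * y' + w * w')"

fun mat_apply :: "matrix2 \<Rightarrow> int \<times> int \<Rightarrow> int \<times> int" where
  "mat_apply (x, y, z, w) (s, t) = (x * s + y * t, z * s + w * t)"

fun congruent_to_one :: "int \<Rightarrow> matrix2 \<Rightarrow> bool" where
  "congruent_to_one q (x, y, z, w) \<longleftrightarrow> q dvd x - 1 \<and> q dvd y \<and> q dvd z \<and> q dvd w - 1"

fun mat_det :: "matrix2 \<Rightarrow> int" where
  "mat_det (x, y, z, w) = x * w - y * z"

fun mat_adj :: "matrix2 \<Rightarrow> matrix2" where
  "mat_adj (x, y, z, w) = (w, - y, - z, x)"

text \<open>The principal congruence subgroup \<Gamma>(q) of
  \<open>SL\<^sub>2(\<int>)\<close>.\<close>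

definition congruence_group :: "int \<Rightarrow> matrix2 monoid" where
  "congruence_group q =
     \<lparr>carrier = {g. congruent_to_one q g \<and> mat_det g = 1}, monoid.mult = mat_mult, one = (1, 0, 0, 1)\<rparr>"

lemma congruence_group_simps [simp]:
  "g \<in> carrier (congruence_group q) \<longleftrightarrow> congruent_to_one q g \<and> mat_det g = 1"
  "monoid.mult (congruence_group q) = mat_mult"
  "one (congruence_group q) = (1, 0, 0, 1)"
  by (simp_all add: congruence_group_def)

lemma mat_apply_mult: "mat_apply (mat_mult g h) v = mat_apply g (mat_apply h v)"
  by (cases g; cases h; cases v) (simp add: algebra_simps)

lemma mat_mult_assoc: "mat_mult (mat_mult g h) k = mat_mult g (mat_mult h k)"
  by (cases g; cases h; cases k) (simp add: algebra_simps)

lemma mat_det_mult: "mat_det (mat_mult g h) = mat_det g * mat_det h"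
  by (cases g; cases h) (simp add: algebra_simps)

lemma mat_adj_mult: "mat_det g = 1 \<Longrightarrow> mat_mult (mat_adj g) g = (1, 0, 0, 1)"
  by (cases g) (simp add: algebra_simps)

lemma congruent_to_one_mult:
  assumes "congruent_to_one q g" "congruent_to_one q h"
  shows "congruent_to_one q (mat_mult g h)"
proof -
  obtain x y z w x' y' z' w' where gh: "g = (x, y, z, w)" "h = (x', y', z', w')"
    by (metis prod_cases4)
  have "x * x' + y * z' - 1 = (x - 1) * x' + (x' - 1) + y * z'"
    "x * y' + y * w' = x * y' + y * w'"
    "z * x' + w * z' = z * x' + w * z'"
    "z * y' + w * w' - 1 = z * y' + ((w - 1) * w' + (w' - 1))"
    by (simp_all add: algebra_simps)
  then show ?thesis using assms unfolding gh congruent_to_one.simps mat_mult.simps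
    by (metis dvd_add dvd_mult dvd_mult2)
qed

lemma congruent_to_one_adj: "congruent_to_one q g \<Longrightarrow> congruent_to_one q (mat_adj g)"
  by (cases g) auto

lemma mat_det_adj: "mat_det (mat_adj g) = mat_det g"
  by (cases g) auto

lemma group_congruence_group: "group (congruence_group q)"
proof (rule groupI)
  fix g assume "g \<in> carrier (congruence_group q)"
  then show "\<one>\<^bsub>congruence_group q\<^esub> \<otimes>\<^bsub>congruence_group q\<^esub> g = g"
    and "\<exists>h\<in>carrier (congruence_group q). h \<otimes>\<^bsub>congruence_group q\<^esub> g = \<one>\<^bsub>congruence_group q\<^esub>"
    by (cases g, simp)
      (use \<open>g \<in> _\<close> in \<open>auto intro!: bexI[of _ "mat_adj g"]
        simp: mat_adj_mult congruent_to_one_adj mat_det_adj\<close>)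
qed (auto simp: congruent_to_one_mult mat_det_mult mat_mult_assoc)

lemma inv_congruence_group:
  assumes "g \<in> carrier (congruence_group q)"
  shows "inv\<^bsub>congruence_group q\<^esub> g = mat_adj g"
  using assms mat_adj_mult[of g]
  by (intro group.inv_equality[OF group_congruence_group])
    (auto simp: congruent_to_one_adj mat_det_adj)

text \<open>For \<open>h = 1 + r X\<close> the conjugate by \<open>g\<close> is
  \<open>1 + r (g X g\<^sup>-\<^sup>1)\<close>; the entries of \<open>X\<close> are
  \<open>\<alpha>\<close>, \<open>\<beta>\<close>, \<open>\<gamma>\<close>, \<open>\<delta>\<close>
  in the proof.\<close>

lemma normal_congruence_subgroup:
  assumes "q dvd r"
  shows "carrier (congruence_group r) \<lhd> congruence_group q"
proof -
  interpret group "congruence_group q" by (rule group_congruence_group)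
  show ?thesis
    unfolding normal_inv_iff
  proof (intro conjI ballI)
    have sub: "g \<in> carrier (congruence_group q)" if "g \<in> carrier (congruence_group r)" for g
      using that by (cases g) (auto intro: dvd_trans[OF assms])
    show "subgroup (carrier (congruence_group r)) (congruence_group q)"
    proof (rule subgroupI)
      have "(1, 0, 0, 1) \<in> carrier (congruence_group r)" by simp
      then show "carrier (congruence_group r) \<noteq> {}" by blast
      show "inv\<^bsub>congruence_group q\<^esub> g \<in> carrier (congruence_group r)"
        if g: "g \<in> carrier (congruence_group r)" for g
        using g inv_congruence_group[OF sub[OF g]] by (simp add: congruent_to_one_adj mat_det_adj)
    qed (use sub in \<open>auto simp only: congruence_group_simps congruent_to_one_mult mat_det_mult mult_1\<close>)
    fix g h assume gh: "g \<in> carrier (congruence_group q)" "h \<in> carrier (congruence_group r)"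
    obtain x y z w x' y' z' w' where e: "g = (x, y, z, w)" "h = (x', y', z', w')"
      by (metis prod_cases4)
    have d: "x * w - y * z = 1" using gh(1) by (simp add: e)
    obtain \<alpha> \<beta> \<gamma> \<delta> where h: "x' = r * \<alpha> + 1" "y' = r * \<beta>" "z' = r * \<gamma>" "w' = r * \<delta> + 1"
      using gh(2) by (auto simp: e dvd_def) (metis diff_add_cancel)
    have "mat_mult (mat_mult g h) (mat_adj g) =
       (r * (x * \<alpha> * w + y * \<gamma> * w - x * \<beta> * z - y * \<delta> * z) + (x * w - y * z),
        r * (- x * \<alpha> * y - y * \<gamma> * y + x * \<beta> * x + y * \<delta> * x),
        r * (z * \<alpha> * w + w * \<gamma> * w - z * \<beta> * z - w * \<delta> * z),
        r * (- z * \<alpha> * y - w * \<gamma> * y + z * \<beta> * x + w * \<delta> * x) + (x * w - y * z))"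
      by (simp add: e h algebra_simps)
    then have "congruent_to_one r (mat_mult (mat_mult g h) (mat_adj g))"
      by (simp add: d)
    then show "g \<otimes>\<^bsub>congruence_group q\<^esub> h \<otimes>\<^bsub>congruence_group q\<^esub> inv\<^bsub>congruence_group q\<^esub> g
        \<in> carrier (congruence_group r)"
      using gh by (simp add: inv_congruence_group mat_det_mult mat_det_adj)
  qed
qed

text \<open>Residue matrices are coded as natural numbers because \<open>pro_topology\<close> ranges
  over groups of type \<open>nat monoid\<close>.\<close>

fun residue_code :: "int \<Rightarrow> matrix2 \<Rightarrow> nat" where
  "residue_code r (x, y, z, w) = to_nat (x mod r, y mod r, z mod r, w mod r)"

text \<open>\<open>mat_adj h\<close> is the inverse of \<open>h\<close>, so the fibres of the code
  are cosets of a congruence subgroup.\<close>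

lemma residue_code_eq_iff:
  assumes "mat_det g = 1" "mat_det h = 1"
  shows "residue_code r g = residue_code r h \<longleftrightarrow> congruent_to_one r (mat_mult g (mat_adj h))"
proof -
  obtain x y z w x' y' z' w' where e: "g = (x, y, z, w)" "h = (x', y', z', w')"
    by (metis prod_cases4)
  have d: "x * w - y * z = 1" "x' * w' - y' * z' = 1" using assms by (simp_all add: e)
  have "r dvd x * w' - y * z' - 1 \<and> r dvd y * x' - x * y' \<and> r dvd z * w' - w * z' \<and> r dvd w * x' - z * y' - 1"
    if "r dvd x - x'" "r dvd y - y'" "r dvd z - z'" "r dvd w - w'"
  proof -
    have eqs: "x * w' - y * z' - 1 = (x - x') * w' - (y - y') * z'"
      "y * x' - x * y' = (y - y') * x' - (x - x') * y'"
      "z * w' - w * z' = (z - z') * w' - (w - w') * z'"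
      "w * x' - z * y' - 1 = (w - w') * x' - (z - z') * y'"
      using d by (simp_all add: algebra_simps)
    show ?thesis unfolding eqs by (intro conjI dvd_diff dvd_mult2 that)
  qed
  moreover have "r dvd x - x' \<and> r dvd y - y' \<and> r dvd z - z' \<and> r dvd w - w'"
    if "r dvd x * w' - y * z' - 1" "r dvd y * x' - x * y'" "r dvd z * w' - w * z'"
      "r dvd w * x' - z * y' - 1"
  proof -
    \<comment> \<open>The entries of \<open>(g h\<^sup>-\<^sup>1 - 1) h = g - h\<close>, with the
      determinant of \<open>h\<close> kept as a factor so that they are polynomial
      identities.\<close>
    have eqs: "x * (x' * w' - y' * z') - x' = (x * w' - y * z' - 1) * x' + (y * x' - x * y') * z'"
      "y * (x' * w' - y' * z') - y' = (x * w' - y * z' - 1) * y' + (y * x' - x * y') * w'"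
      "z * (x' * w' - y' * z') - z' = (z * w' - w * z') * x' + (w * x' - z * y' - 1) * z'"
      "w * (x' * w' - y' * z') - w' = (z * w' - w * z') * y' + (w * x' - z * y' - 1) * w'"
      by (simp_all add: algebra_simps)
    note eqs = eqs[unfolded d mult_1_right]
    show ?thesis unfolding eqs by (intro conjI dvd_add dvd_mult2 that)
  qed
  ultimately show ?thesis
    by (auto simp: e mod_eq_dvd_iff algebra_simps)
qed

text \<open>For \<open>g = 1 + q X\<close> the power is \<open>1 + n q X\<close> modulo
  \<open>q\<^sup>2\<close>, and \<open>n q\<close> divides \<open>q\<^sup>2\<close>. The index
  \<open>q'\<close> is free because powers are computed alike in all congruence groups.\<close>

lemma congruent_to_one_pow:
  assumes "congruent_to_one q g" "int n dvd q"
  shows "congruent_to_one (int n * q) (g [^]\<^bsub>congruence_group q'\<^esub> n)"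
proof -
  obtain x y z w where g: "g = (q * x + 1, q * y, q * z, q * w + 1)"
    using assms(1) by (cases g) (auto simp: dvd_def, metis diff_add_cancel)
  have "\<exists>A B C D. g [^]\<^bsub>congruence_group q'\<^esub> k =
      (q * int k * x + 1 + q * q * A, q * int k * y + q * q * B,
       q * int k * z + q * q * C, q * int k * w + 1 + q * q * D)" for k :: nat
  proof (induction k)
    case 0
    show ?case by (intro exI[of _ 0]) simp
  next
    case (Suc k)
    then obtain A B C D where IH: "g [^]\<^bsub>congruence_group q'\<^esub> k =
      (q * int k * x + 1 + q * q * A, q * int k * y + q * q * B,
       q * int k * z + q * q * C, q * int k * w + 1 + q * q * D)" by blast
    show ?case
      \<comment> \<open>With \<open>R\<close> the matrix of \<open>A\<close>, \<open>B\<close>,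
        \<open>C\<close>, \<open>D\<close>, expanding
        \<open>(1 + k q X + q\<^sup>2 R) (1 + q X)\<close> gives the new remainder
        \<open>R + k X\<^sup>2 + q R X\<close>.\<close>
      by (rule exI[of _ "A + int k * (x * x + y * z) + q * (A * x + B * z)"],
          rule exI[of _ "B + int k * (x * y + y * w) + q * (A * y + B * w)"],
          rule exI[of _ "C + int k * (z * x + w * z) + q * (C * x + D * z)"],
          rule exI[of _ "D + int k * (z * y + w * w) + q * (C * y + D * w)"])
        (simp only: nat_pow_Suc, subst IH, simp add: g algebra_simps)
  qed
  then obtain A B C D where *: "g [^]\<^bsub>congruence_group q'\<^esub> n =
      (q * int n * x + 1 + q * q * A, q * int n * y + q * q * B,
       q * int n * z + q * q * C, q * int n * w + 1 + q * q * D)" by blast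
  have "int n * q dvd q * q" using assms(2) by simp
  moreover have "int n * q dvd q * int n * t" for t by (simp add: mult.commute)
  ultimately have "int n * q dvd q * int n * t + q * q * s" for s t
    by (meson dvd_add dvd_mult2)
  then show ?thesis unfolding * by (simp add: add.commute add.left_commute)
qed

text \<open>Each \<open>p\<close>-th power gains one more factor \<open>p\<close>, starting from
  \<Gamma>(p).\<close>

lemma congruence_group_exponent:
  assumes "g \<in> carrier (congruence_group (int p))"
  shows "g [^]\<^bsub>congruence_group (int p)\<^esub> p ^ k \<in> carrier (congruence_group (int p ^ Suc k))"
proof -
  let ?G = "congruence_group (int p)"
  interpret group ?G by (rule group_congruence_group)
  have "congruent_to_one (int p ^ Suc k) (g [^]\<^bsub>?G\<^esub> p ^ k)"
  proof (induction k)
    case 0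
    then show ?case using assms nat_pow_eone[OF assms] by simp
  next
    case (Suc k)
    have "congruent_to_one (int p * int p ^ Suc k) ((g [^]\<^bsub>?G\<^esub> p ^ k) [^]\<^bsub>?G\<^esub> p)"
      by (rule congruent_to_one_pow[OF Suc]) simp
    then show ?case using nat_pow_pow[OF assms] by (simp add: mult.commute)
  qed
  then show ?thesis using nat_pow_closed[OF assms, of "p ^ k"] by simp
qed

text \<open>The transvection \<open>v \<mapsto> v + m (y - c x) (1, c)\<close> of \<open>v = (x, y)\<close>, which fixes \<open>(1, c)\<close>.\<close>

definition transvection :: "int \<Rightarrow> int \<Rightarrow> matrix2" where
  "transvection m c = (1 - m * c, m, - (m * c * c), 1 + m * c)"

lemma transvection_closed: "q dvd m \<Longrightarrow> transvection m c \<in> carrier (congruence_group q)"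
  by (simp add: transvection_def algebra_simps)

lemma inv_transvection:
  "q dvd m \<Longrightarrow> inv\<^bsub>congruence_group q\<^esub> (transvection m c) = transvection (- m) c"
  using transvection_closed[of q m c]
  by (subst inv_congruence_group) (simp_all add: transvection_def)

text \<open>With \<open>c = m i\<close>, the transvection acts on the coordinate \<open>x / (y - c x)\<close> as translation by \<open>m\<close>;
  the sectors of the letters \<open>a i\<close> and \<open>(a i)\<^sup>-\<^sup>1\<close> are the sets where this coordinate is \<open>> 1\<close> and \<open>< - 1\<close>.\<close>

definition sector :: "int \<Rightarrow> nat \<times> bool \<Rightarrow> (int \<times> int) set" where
  "sector m l = {(x, y). let t = y - m * int (fst l) * x
                         in t * t < (if snd l then x * t else - (x * t))}"

text \<open>Membership forces \<open>\<bar>t\<bar> < \<bar>x\<bar>\<close>. For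
  \<open>i \<noteq> j\<close> the difference \<open>t' - t = m (j - i) x\<close> has absolute value
  at least \<open>3 \<bar>x\<bar>\<close>, so \<open>\<bar>t'\<bar> > \<bar>x\<bar>\<close> and both
  sectors of index \<open>i\<close> are avoided. For \<open>i = j\<close> opposite signs exclude
  each other. The last hypothesis is compatibility of adjacent letters.\<close>

lemma sector_imp:
  assumes "(x, y) \<in> sector m (j, r)" and "m \<ge> 3" and "i = j \<longrightarrow> r = s"
  shows "y - m * int i * x \<noteq> 0" and "(x, y) \<notin> sector m (i, \<not> s)"
proof -
  define t where "t = y - m * int j * x"
  define t' where "t' = y - m * int i * x"
  have t: "t * t < (if r then x * t else - (x * t))"
    using assms(1) by (simp add: sector_def t_def Let_def split: if_splits)
  have "t' \<noteq> 0 \<and> \<not> t' * t' < (if \<not> s then x * t' else - (x * t'))"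
  proof (cases "i = j")
    case True
    then have "t' = t" "r = s" using assms(3) by (simp_all add: t_def t'_def)
    moreover have "t \<noteq> 0" using t by (auto split: if_splits)
    moreover have "0 \<le> t * t" by simp
    then have "\<not> t * t < (if \<not> s then x * t else - (x * t))" using t \<open>r = s\<close>
      by (cases s; simp only: if_True if_False not_True_eq_False not_False_eq_True; linarith)
    ultimately show ?thesis by (simp split: if_splits)
  next
    case False
    have le: "t * t < \<bar>x\<bar> * \<bar>t\<bar>" using t by (auto simp: abs_mult[symmetric] split: if_splits)
    then have "\<bar>t\<bar> * \<bar>t\<bar> < \<bar>x\<bar> * \<bar>t\<bar>" by simp
    then have tx: "\<bar>t\<bar> < \<bar>x\<bar>" by (rule mult_right_less_imp_less) simp
    have "1 \<le> \<bar>int j - int i\<bar>" using False by auto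
    then have "3 * 1 \<le> m * \<bar>int j - int i\<bar>" using assms(2) by (intro mult_mono) auto
    then have "3 * \<bar>x\<bar> \<le> m * \<bar>int j - int i\<bar> * \<bar>x\<bar>" by (intro mult_right_mono) auto
    also have "\<dots> = \<bar>m * (int j - int i) * x\<bar>" using assms(2) by (simp add: abs_mult)
    also have "m * (int j - int i) * x = t' - t" by (simp add: t_def t'_def algebra_simps)
    finally have tx': "\<bar>x\<bar> < \<bar>t'\<bar>" using tx by arith
    then have "\<bar>x\<bar> * \<bar>t'\<bar> \<le> \<bar>t'\<bar> * \<bar>t'\<bar>" by (intro mult_right_mono) auto
    then show ?thesis using tx' by (auto simp: abs_mult[symmetric])
  qed
  then show "y - m * int i * x \<noteq> 0" "(x, y) \<notin> sector m (i, \<not> s)"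
    by (simp_all add: t'_def sector_def Let_def split: if_splits)
qed

text \<open>At \<open>(1, 0)\<close> the coordinate is \<open>- 1 / (m i)\<close>, of absolute value
  below 1.\<close>

lemma base_point_not_in_sector:
  assumes "m \<ge> 3" "i > 0"
  shows "(1, 0) \<notin> sector m (i, s)"
proof -
  define t where "t = m * int i"
  have "1 \<le> t" using assms by (simp add: t_def) (metis int_one_le_iff_zero_less mult_pos_pos of_nat_0_less_iff order_less_le_trans zero_less_numeral)
  then have "t \<le> t * t" using mult_left_mono[of 1 t t] by simp
  then have "\<not> t * t < t" "\<not> t * t < - t" using \<open>1 \<le> t\<close> by linarith+
  then show ?thesis
    by (simp add: sector_def Let_def t_def[symmetric])
qed

text \<open>For \<open>s\<close> true, the coordinate is at least \<open>- 1\<close> outside the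
  sector of the inverse letter, and translation by \<open>m \<ge> 3\<close> takes it above 1; the
  other sign is symmetric. Multiplying by \<open>t * t > 0\<close> keeps the inequalities in the
  integers.\<close>

lemma transvection_sector:
  assumes "y - m * int i * x \<noteq> 0" "(x, y) \<notin> sector m (i, \<not> s)" "m \<ge> 3"
  shows "mat_apply (transvection (if s then m else - m) (m * int i)) (x, y) \<in> sector m (i, s)"
proof -
  define c where "c = m * int i"
  define t where "t = y - c * x"
  define \<mu> where "\<mu> = (if s then m else - m)"
  have t0: "t * t > 0" using assms(1) by (simp add: t_def c_def zero_less_mult_iff) arith
  have le: "- (t * t) \<le> (if s then x * t else - (x * t))"
    using assms(2) by (auto simp: sector_def Let_def c_def[symmetric] t_def[symmetric])
  have "3 * (t * t) \<le> m * (t * t)" using assms(3) by (intro mult_right_mono) auto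
  then have "t * t < (if s then (x + \<mu> * t) * t else - ((x + \<mu> * t) * t))"
    using le t0 by (auto simp: \<mu>_def algebra_simps)
  moreover have "mat_apply (transvection \<mu> c) (x, y) = (x + \<mu> * t, c * (x + \<mu> * t) + t)"
    by (simp add: transvection_def t_def algebra_simps)
  ultimately show ?thesis
    by (simp add: sector_def Let_def c_def[symmetric] \<mu>_def[symmetric] split: if_splits)
qed

text \<open>The last letter acts first and moves \<open>(1, 0)\<close> into its sector; each further
  letter is compatible with the one before it and moves the point into its own sector. Index 0 is
  excluded because its transvection fixes \<open>(1, 0)\<close>.\<close>

lemma ping_pong:
  assumes "ws \<in> reduced_words I" "ws \<noteq> []" "0 \<notin> I" "m \<ge> 3" "q dvd m"
  shows "mat_apply (word_value (congruence_group q) (\<lambda>i. transvection m (m * int i)) ws) (1, 0)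
           \<in> sector m (hd ws)"
  using assms(1,2)
proof (induction ws)
  case (Cons l ws)
  note prem = Cons.prems(1) and IH = Cons.IH
  obtain i s where l: "l = (i, s)" by (cases l)
  let ?v = "mat_apply (word_value (congruence_group q) (\<lambda>i. transvection m (m * int i)) ws) (1, 0)"
  obtain x y where v: "?v = (x, y)" by (cases ?v)
  have i: "i > 0" using Cons.prems assms(3) reduced_words_lists[OF Cons.prems(1)]
    by (cases i) (auto simp: l)
  have "y - m * int i * x \<noteq> 0 \<and> (x, y) \<notin> sector m (i, \<not> s)"
  proof (cases ws)
    case Nil
    then have "x = 1" "y = 0" using v by simp_all
    then show ?thesis using base_point_not_in_sector[OF assms(4) i] i assms(4) by simp
  next
    case (Cons l' ws')
    obtain j r where l': "l' = (j, r)" by (cases l')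
    have "ws \<in> reduced_words I" "compatible l l'"
      using prem reduced_words_append[of "[l]" ws I] by (simp_all add: Cons)
    then have "(x, y) \<in> sector m (j, r)" "i = j \<longrightarrow> r = s"
      using IH v by (auto simp: Cons l l' compatible_def)
    then show ?thesis using sector_imp[OF _ assms(4), of x y j r i s] by simp
  qed
  then have "mat_apply (transvection (if s then m else - m) (m * int i)) (x, y) \<in> sector m (i, s)"
    using transvection_sector[of y m i x s] assms(4) by simp
  then show ?case
    using v assms(5) by (auto simp: l mat_apply_mult inv_transvection split: if_splits)
qed simp

section \<open>Residual finiteness and the pseudovariety\<close>

context free_group
begin

lemma hom_val:
  assumes "f \<in> hom F H" "group H" "\<And>i. i \<in> I \<Longrightarrow> f (a i) = b i" "ws \<in> lists (I \<times> UNIV)"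
  shows "f (val ws) = word_value H b ws"
proof -
  interpret f: group_hom F H f
    using assms(1,2) by (simp add: group_hom_def group_hom_axioms_def is_group)
  show ?thesis using assms(4)
  proof (induction ws)
    case (Cons x ws)
    then show ?case
      using assms(3) basis_closed val_closed[of ws] by (cases x) (auto simp: Pi_iff)
  qed simp
qed

lemma hom_extension:
  assumes "group H" "b \<in> I \<rightarrow> carrier H"
  obtains f where "f \<in> hom F H" "\<And>i. i \<in> I \<Longrightarrow> f (a i) = b i"
  using free_basis_universal[OF free assms] by blast

lemma hom_eqI:
  assumes "f \<in> hom F H" "g \<in> hom F H" "group H" "\<And>i. i \<in> I \<Longrightarrow> f (a i) = g (a i)"
    and "x \<in> carrier F"
  shows "f x = g x"
proof -
  obtain ws where "ws \<in> reduced_words I" "val ws = x" using obtain_word[OF assms(5)] .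
  then show ?thesis
    using hom_val[OF assms(1,3), of "\<lambda>i. g (a i)"] hom_val[OF assms(2,3), of "\<lambda>i. g (a i)"] assms(4)
    by (metis reduced_words_lists)
qed

theorem residually_finite_p:
  fixes p :: nat
  assumes "p > 1" "0 \<notin> I" "x \<in> carrier F" "x \<noteq> \<one>"
  obtains H :: "nat monoid" and f M where "group H" "finite (carrier H)"
    "\<And>y. y \<in> carrier H \<Longrightarrow> y [^]\<^bsub>H\<^esub> p ^ M = \<one>\<^bsub>H\<^esub>" "f \<in> hom F H" "f x \<noteq> \<one>\<^bsub>H\<^esub>"
proof -
  define q where "q = int p"
  let ?G = "congruence_group q"
  interpret G: group ?G by (rule group_congruence_group)
  \<comment> \<open>A multiple of \<open>q\<close>, so that the transvections lie in \<Gamma>(p),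
    and at least 3 for ping-pong.\<close>
  define m where "m = 3 * q"
  have m: "m \<ge> 3" "q dvd m" using assms(1) by (simp_all add: m_def q_def)
  obtain \<rho> where \<rho>: "\<rho> \<in> hom F ?G" "\<And>i. i \<in> I \<Longrightarrow> \<rho> (a i) = transvection m (m * int i)"
    using hom_extension[OF G.is_group, of "\<lambda>i. transvection m (m * int i)"] transvection_closed[OF m(2)]
    by auto
  obtain ws where ws: "ws \<in> reduced_words I" "val ws = x" using obtain_word[OF assms(3)] .
  have ne: "ws \<noteq> []" using ws(2) assms(4) by auto
  have "mat_apply (\<rho> x) (1, 0) \<in> sector m (hd ws)"
    using ping_pong[OF ws(1) ne assms(2) m] hom_val[OF \<rho>(1) G.is_group \<rho>(2) reduced_words_lists[OF ws(1)]]
    by (simp add: ws(2))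
  moreover have "fst (hd ws) > 0"
    using reduced_words_lists[OF ws(1)] ne assms(2) by (cases ws) (auto intro: Suc_leI gr0I)
  ultimately have "\<rho> x \<noteq> (1, 0, 0, 1)"
    using base_point_not_in_sector[OF m(1), of "fst (hd ws)" "snd (hd ws)"] by auto
  obtain r s t u where rx: "\<rho> x = (r, s, t, u)" by (cases "\<rho> x")
  \<comment> \<open>\<open>k\<close> bounds every entry of \<open>\<rho> x - 1\<close>; as
    \<open>q ^ Suc k\<close> exceeds \<open>k\<close>, it divides such an entry only if the entry is
    0.\<close>
  define k where "k = nat (\<bar>r - 1\<bar> + \<bar>s\<bar> + \<bar>t\<bar> + \<bar>u - 1\<bar>)"
  have "k < p ^ k" using power_gt_expt[of p k] assms(1) by simp
  also have "p ^ k \<le> p ^ Suc k" using assms(1) by simp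
  finally have "int k < q ^ Suc k" unfolding q_def by (metis of_nat_less_iff of_nat_power)
  have nk: "\<not> congruent_to_one (q ^ Suc k) (\<rho> x)"
  proof -
    have z: "v = 0" if "q ^ Suc k dvd v" "\<bar>v\<bar> \<le> int k" for v
      using that \<open>int k < q ^ Suc k\<close> dvd_imp_le_int[of v "q ^ Suc k"] by (cases "v = 0") auto
    show ?thesis
    proof
      assume "congruent_to_one (q ^ Suc k) (\<rho> x)"
      then have d: "q ^ Suc k dvd r - 1" "q ^ Suc k dvd s" "q ^ Suc k dvd t" "q ^ Suc k dvd u - 1"
        unfolding rx congruent_to_one.simps by blast+
      have "\<bar>r - 1\<bar> \<le> int k" "\<bar>s\<bar> \<le> int k" "\<bar>t\<bar> \<le> int k" "\<bar>u - 1\<bar> \<le> int k"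
        unfolding k_def by linarith+
      then have "r - 1 = 0" "s = 0" "t = 0" "u - 1 = 0" using d[THEN z] by blast+
      then show False using \<open>\<rho> x \<noteq> (1, 0, 0, 1)\<close> by (simp add: rx)
    qed
  qed
  let ?K = "carrier (congruence_group (q ^ Suc k))"
  let ?c = "residue_code (q ^ Suc k)"
  \<comment> \<open>The fibres of the code are the cosets of \<open>?K\<close>, so its image
    inherits the quotient group structure.\<close>
  have "weak_group_morphism ?c ?K ?G"
    by (rule weak_group_morphismsI[OF normal_congruence_subgroup])
      (auto simp: residue_code_eq_iff inv_congruence_group mat_det_mult mat_det_adj)
  note hom = G.weak_group_morphism_group_hom[OF this]
  define H where "H = image_group ?c ?G"
  interpret c: group_hom ?G H ?c using hom by (simp add: H_def)
  have one: "?c g = \<one>\<^bsub>H\<^esub> \<longleftrightarrow> congruent_to_one (q ^ Suc k) g" if "g \<in> carrier ?G" for g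
  proof -
    have "mat_mult g (mat_adj (1, 0, 0, 1)) = g" by (cases g) simp
    then show ?thesis
      using that residue_code_eq_iff[of g "(1, 0, 0, 1)" "q ^ Suc k"] by (simp add: H_def image_group_one)
  qed
  have "carrier H \<subseteq> to_nat ` ({0..<q ^ Suc k} \<times> {0..<q ^ Suc k} \<times> {0..<q ^ Suc k} \<times> {0..<q ^ Suc k})"
    using assms(1) by (auto simp: H_def image_group_carrier q_def simp del: power_Suc)
  then have "finite (carrier H)" by (rule finite_subset) simp
  moreover have "y [^]\<^bsub>H\<^esub> p ^ k = \<one>\<^bsub>H\<^esub>" if "y \<in> carrier H" for y
  proof -
    obtain g where g: "g \<in> carrier ?G" "y = ?c g" using \<open>y \<in> carrier H\<close> unfolding H_def image_group_carrier by blast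
    have "congruent_to_one (q ^ Suc k) (g [^]\<^bsub>?G\<^esub> p ^ k)"
      using congruence_group_exponent[of g p k] g(1) by (simp add: q_def)
    then show ?thesis
      using one[OF G.nat_pow_closed[OF g(1)]] c.hom_nat_pow[OF g(1)] g(2) by metis
  qed
  moreover have "?c \<circ> \<rho> \<in> hom F H" by (rule Group.hom_compose[OF \<rho>(1) c.homh])
  moreover have "(?c \<circ> \<rho>) x \<noteq> \<one>\<^bsub>H\<^esub>"
    using one[of "\<rho> x"] nk hom_in_carrier[OF \<rho>(1) assms(3)] by simp
  ultimately show ?thesis using that c.H.is_group by blast
qed

end

text \<open>A prime \<open>r \<noteq> p\<close> dividing the order would give an element of order
  \<open>r\<close>, against the exponent. So the order is a power of \<open>p\<close>, and the whole
  group is its Sylow subgroup, with trivial quotient.\<close>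

lemma (in group) finite_p_group_pseudovariety:
  assumes "Factorial_Ring.prime p" "finite (carrier G)" "\<And>x. x \<in> carrier G \<Longrightarrow> x [^] p ^ M = \<one>"
  shows "pseudovariety_V p G"
proof -
  have o: "order G > 0" using assms(2) order_gt_0_iff_finite by blast
  obtain k where k: "order G = p ^ multiplicity p (order G) * k" "\<not> p dvd k"
    by (rule multiplicity_decompose'[of "order G" p]) (use assms(1) o not_prime_unit[of p] in auto)
  have "k = 1"
  proof (rule ccontr)
    assume "k \<noteq> 1"
    then obtain r where r: "Factorial_Ring.prime r" "r dvd k" using prime_factor_nat by blast
    \<comment> \<open>With exponent 1, Sylow's theorem serves as Cauchy's theorem.\<close>
    obtain l where l: "order G = r ^ 1 * l" using r(2) k(1) by (metis dvd_def mult.left_commute power_one_right)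
    obtain Q where Q: "subgroup Q G" "card Q = r"
      using sylow_thm[OF r(1) is_group l assms(2)] by auto
    have "Q \<noteq> {\<one>}" using Q(2) r(1) by auto
    then obtain x where x: "x \<in> Q" "x \<noteq> \<one>" using subgroup.one_closed[OF Q(1)] by auto
    interpret Q: group "G\<lparr>carrier := Q\<rparr>" using subgroup.subgroup_is_group[OF Q(1) is_group] .
    have xG: "x \<in> carrier G" using x(1) subgroup.subset[OF Q(1)] by auto
    have "x [^] r = \<one>"
      using Q.pow_order_eq_1[of x] x(1) Q(2) by (simp add: order_def flip: nat_pow_consistent)
    then have "ord x dvd r" "ord x dvd p ^ M" using pow_eq_id[OF xG] assms(3)[OF xG] by auto
    moreover have "coprime r (p ^ M)"
      using r k(2) assms(1) by (metis primes_coprime coprime_power_right_iff)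
    ultimately have "ord x = 1" by (meson coprime_def nat_dvd_1_iff_1)
    then show False using x(2) ord_eq_1[OF xG] by simp
  qed
  then have syl: "sylow_subgroup p (carrier G) G"
    using k(1) subgroup_self by (simp add: sylow_subgroup_def order_def)
  have norm: "carrier G \<lhd> G" by (rule normal_self)
  interpret Q: group "G Mod carrier G" using normal.factorgroup_is_group[OF norm] .
  have "carrier G #> x = carrier G" if "x \<in> carrier G" for x
    using coset_join2[OF that subgroup_self that] .
  then have triv: "C = \<one>\<^bsub>G Mod carrier G\<^esub>" if "C \<in> carrier (G Mod carrier G)" for C
    using that by (auto simp: FactGroup_def RCOSETS_def split: if_splits)
  have "comm_group (G Mod carrier G)"
    by (rule Q.group_comm_groupI) (metis triv)
  then show ?thesis
    unfolding pseudovariety_V_def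
    using is_group assms(2) norm syl triv Q.nat_pow_closed by blast
qed

text \<open>As \<open>p\<close> does not divide \<open>p - 1\<close>, the trivial subgroup is the
  Sylow subgroup; the exponent condition is Lagrange's theorem.\<close>

lemma (in comm_group) abelian_pseudovariety:
  assumes "p > 1" "order G = p - 1"
  shows "pseudovariety_V p G"
proof -
  have fin: "finite (carrier G)" using assms order_gt_0_iff_finite by simp
  have n: "{\<one>} \<lhd> G" by (rule one_is_normal)
  have "\<not> p dvd p - 1" using assms(1) by (auto dest: dvd_imp_le)
  then have "sylow_subgroup p {\<one>} G"
    using triv_subgroup by (simp add: sylow_subgroup_def assms(2) not_dvd_imp_multiplicity_0)
  moreover have "C [^]\<^bsub>G Mod {\<one>}\<^esub> (p - 1) = \<one>\<^bsub>G Mod {\<one>}\<^esub>" if "C \<in> carrier (G Mod {\<one>})" for C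
  proof -
    obtain x where x: "x \<in> carrier G" "C = {\<one>} #> x" using \<open>C \<in> _\<close> by (auto simp: FactGroup_def RCOSETS_def)
    have "C [^]\<^bsub>G Mod {\<one>}\<^esub> (p - 1) = {\<one>} #> (x [^] (p - 1))"
      using normal.FactGroup_pow[OF n] x by simp
    also have "x [^] (p - 1) = \<one>" using pow_order_eq_1[OF x(1)] assms(2) by simp
    finally show ?thesis by (simp add: r_coset_def)
  qed
  ultimately show ?thesis
    unfolding pseudovariety_V_def
    using is_group fin n abelian_FactGroup[OF triv_subgroup] by blast
qed

lemma pseudovariety_exponent:
  assumes "pseudovariety_V p H"
  obtains P k where "P \<lhd> H" "comm_group (H Mod P)"
    "\<And>C. C \<in> carrier (H Mod P) \<Longrightarrow> C [^]\<^bsub>H Mod P\<^esub> (p - 1) = \<one>\<^bsub>H Mod P\<^esub>"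
    "\<And>x. x \<in> P \<Longrightarrow> x [^]\<^bsub>H\<^esub> p ^ k = \<one>\<^bsub>H\<^esub>"
proof -
  obtain P where P: "group H" "finite (carrier H)" "P \<lhd> H" "sylow_subgroup p P H" "comm_group (H Mod P)"
    "\<And>C. C \<in> carrier (H Mod P) \<Longrightarrow> C [^]\<^bsub>H Mod P\<^esub> (p - 1) = \<one>\<^bsub>H Mod P\<^esub>"
    using assms by (auto simp: pseudovariety_V_def)
  interpret group H by fact
  have s: "subgroup P H" "card P = p ^ multiplicity p (order H)" using P(4) by (auto simp: sylow_subgroup_def)
  interpret S: group "H\<lparr>carrier := P\<rparr>" using subgroup.subgroup_is_group[OF s(1) is_group] .
  have "x [^]\<^bsub>H\<^esub> p ^ multiplicity p (order H) = \<one>\<^bsub>H\<^esub>" if "x \<in> P" for x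
    using S.pow_order_eq_1[of x] that s(2) by (simp add: order_def flip: nat_pow_consistent)
  then show ?thesis using that P by blast
qed

section \<open>The closure of a cyclic subgroup\<close>

lemma Gcd_eq_linear_combination:
  fixes f :: "'i \<Rightarrow> int"
  assumes "finite I"
  shows "\<exists>c. Gcd (f ` I) = (\<Sum>i\<in>I. c i * f i)"
  using assms
proof (induction I)
  case (insert x I)
  then obtain c where c: "Gcd (f ` I) = (\<Sum>i\<in>I. c i * f i)" by blast
  obtain s t where "s * f x + t * Gcd (f ` I) = gcd (f x) (Gcd (f ` I))" using bezout_int by blast
  moreover have "(\<Sum>i\<in>I. (if i = x then s else t * c i) * f i) = t * Gcd (f ` I)"
    unfolding c sum_distrib_left using insert.hyps(2) by (intro sum.cong) auto
  ultimately show ?case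
    using insert.hyps by (intro exI[of _ "\<lambda>i. if i = x then s else t * c i"]) simp
qed simp

text \<open>It suffices that \<open>gcd e (h * p ^ k)\<close> divides the coefficient of
  \<open>j\<close>. This gcd splits as \<open>b * c\<close> with \<open>b dvd h\<close> and
  \<open>c dvd p ^ k\<close>; both divide \<open>e\<close>, so \<open>b dvd gcd e h\<close> and
  \<open>c\<close> divides the \<open>p\<close>-part of \<open>e\<close>, whatever \<open>k\<close>
  is.\<close>

lemma solve_linear_congruence:
  fixes e h p k :: nat and j :: int
  assumes "Factorial_Ring.prime p" "e > 0"
  obtains s t where "int e * t = int (gcd e h * p ^ multiplicity p e) * j + s * int (h * p ^ k)"
proof -
  obtain b c where bc: "gcd e (h * p ^ k) = b * c" "b dvd h" "c dvd p ^ k"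
    using division_decomp[of "gcd e (h * p ^ k)" h "p ^ k"] by auto
  have "b dvd e" "c dvd e" by (metis bc(1) dvd_mult_left gcd_dvd1, metis bc(1) dvd_mult_right gcd_dvd1)
  obtain i where i: "c = p ^ i" using bc(3) assms(1) divides_primepow_nat by blast
  then have "i \<le> multiplicity p e"
    using \<open>c dvd e\<close> assms not_prime_unit by (intro multiplicity_geI) auto
  then have "c dvd p ^ multiplicity p e" by (simp add: i le_imp_power_dvd)
  then have "gcd e (h * p ^ k) dvd gcd e h * p ^ multiplicity p e"
    unfolding bc(1) using bc(2) \<open>b dvd e\<close> by (intro mult_dvd_mono) auto
  then obtain l where l: "gcd e h * p ^ multiplicity p e = gcd e (h * p ^ k) * l" by (auto elim: dvdE)
  obtain x y where "x * int e + y * int (h * p ^ k) = gcd (int e) (int (h * p ^ k))"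
    using bezout_int by blast
  then have xy: "x * int e + y * int (h * p ^ k) = int (gcd e (h * p ^ k))" by (simp only: gcd_int_int_eq)
  have "int (gcd e h * p ^ multiplicity p e) * j = (x * int e + y * int (h * p ^ k)) * (int l * j)"
    unfolding l xy by simp
  then have "int e * (x * int l * j) =
      int (gcd e h * p ^ multiplicity p e) * j + (- y * int l * j) * int (h * p ^ k)"
    by (simp add: algebra_simps)
  then show ?thesis using that by blast
qed

text \<open>The fibre of \<open>f\<close> through \<open>x\<close> is an open neighbourhood of
  \<open>x\<close>, so it meets \<open>S\<close>.\<close>

lemma separating_pro_topology:
  assumes "group F" "x \<in> pro_topology V F closure_of S" "S \<subseteq> carrier F" "V H" "f \<in> hom F H"
  shows "f x \<in> f ` S"
proof -
  let ?U = "{y \<in> carrier F. f y \<in> {f x}}"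
  have "x \<in> topspace (pro_topology V F)" using assms(2) by (simp add: in_closure_of)
  then have x: "x \<in> carrier F" by (auto simp: pro_topology_def)
  then have "openin (discrete_topology (carrier H)) {f x}" using hom_in_carrier[OF assms(5)] by simp
  then have U: "openin (pro_topology V F) ?U"
    unfolding pro_topology_def using assms(4,5)
    by (intro topology_generated_by_Basis CollectI exI[of _ H] exI[of _ f] exI[of _ "{f x}"] conjI refl)
  have "x \<in> ?U" using x by simp
  then have "\<exists>y. y \<in> S \<and> y \<in> ?U"
    using assms(2)[unfolded in_closure_of, THEN conjunct2, THEN spec[of _ ?U]] U by fast
  then obtain y where "y \<in> S" "y \<in> ?U" by (elim exE conjE)
  then show ?thesis by (intro image_eqI[of _ f y]) auto
qed

lemma (in group) commutes_int_pow:
  assumes "x \<in> carrier G"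
  shows "x [^] (j::int) \<otimes> x = x \<otimes> x [^] j"
  using assms int_pow_mult[OF assms, of j 1] int_pow_mult[OF assms, of 1 j] by (simp add: add.commute)

text \<open>The order of \<open>y\<close> is a power of \<open>p\<close> not dividing
  \<open>p ^ i\<close>, hence a multiple of \<open>p ^ Suc i\<close>, and it divides
  \<open>l\<close>.\<close>

lemma (in group) prime_power_dvd_exponent:
  fixes p :: nat and l :: int
  assumes "Factorial_Ring.prime p" "y \<in> carrier G" "y [^] p ^ M = \<one>" "y [^] l = \<one>"
    "y [^] p ^ i \<noteq> \<one>"
  shows "int (p ^ Suc i) dvd l"
proof -
  have "ord y dvd p ^ M" using assms(2,3) pow_eq_id by simp
  then obtain s where s: "ord y = p ^ s" using assms(1) divides_primepow_nat by blast
  have "\<not> p ^ s dvd p ^ i" using assms(2,5) pow_eq_id s by metis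
  then have "Suc i \<le> s" by (meson le_imp_power_dvd not_less_eq_eq)
  then have "p ^ Suc i dvd ord y" by (simp only: s le_imp_power_dvd)
  moreover have "int (ord y) dvd l" using assms(2,4) int_pow_eq_id by simp
  ultimately show ?thesis by (meson dvd_trans int_dvd_int_iff)
qed

section \<open>Exponent maps, roots and the points of the closure\<close>

context free_group
begin

abbreviation expo :: "nat \<Rightarrow> 'a \<Rightarrow> int" where "expo \<equiv> exponent_hom F I a"

lemma expo_hom: "group_hom F integer_group (expo i)"
  using exponent_hom(1)[OF free] by (simp add: group_hom_def group_hom_axioms_def is_group)

lemma expo_int_pow: "x \<in> carrier F \<Longrightarrow> expo i (x [^] (l::int)) = l * expo i x"
  using group_hom.hom_int_pow[OF expo_hom] by simp

text \<open>Both sides are homomorphisms in \<open>v\<close> that agree on the basis.\<close>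

lemma hom_comm_group_eq_finprod:
  assumes "finite I" "f \<in> hom F C" "comm_group C" "v \<in> carrier F"
  shows "f v = finprod C (\<lambda>i. f (a i) [^]\<^bsub>C\<^esub> expo i v) I"
proof -
  interpret C: comm_group C by fact
  have fa: "f (a i) \<in> carrier C" if "i \<in> I" for i
    using that basis_closed hom_in_carrier[OF assms(2)] by auto
  define g where "g v = finprod C (\<lambda>i. f (a i) [^]\<^bsub>C\<^esub> expo i v) I" for v
  have g: "g \<in> hom F C"
  proof (rule homI)
    show "g (x \<otimes> y) = g x \<otimes>\<^bsub>C\<^esub> g y" if "x \<in> carrier F" "y \<in> carrier F" for x y
    proof -
      have "g (x \<otimes> y) = finprod C (\<lambda>i. f (a i) [^]\<^bsub>C\<^esub> expo i x \<otimes>\<^bsub>C\<^esub> f (a i) [^]\<^bsub>C\<^esub> expo i y) I"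
        unfolding g_def using that fa group_hom.hom_mult[OF expo_hom]
        by (intro C.finprod_cong') (auto simp: C.int_pow_mult)
      then show ?thesis using fa by (simp add: g_def)
    qed
  qed (use fa in \<open>simp add: g_def\<close>)
  have "f (a j) = g (a j)" if j: "j \<in> I" for j
  proof -
    have "g (a j) = finprod C (\<lambda>i. if j = i then f (a i) else \<one>\<^bsub>C\<^esub>) I"
      unfolding g_def using fa exponent_hom(2)[OF free j] by (intro C.finprod_cong') auto
    then show ?thesis using C.finprod_singleton[OF j assms(1), of "\<lambda>i. f (a i)"] fa by simp
  qed
  then show ?thesis using hom_eqI[OF assms(2) g C.is_group _ assms(4)] by (simp add: g_def)
qed

lemma hom_comm_group_eq_one:
  assumes "finite I" "f \<in> hom F C" "comm_group C" "v \<in> carrier F"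
    and C: "\<And>x. x \<in> carrier C \<Longrightarrow> x [^]\<^bsub>C\<^esub> N = \<one>\<^bsub>C\<^esub>"
    and "\<And>i. i \<in> I \<Longrightarrow> int N dvd expo i v"
  shows "f v = \<one>\<^bsub>C\<^esub>"
proof -
  interpret C: comm_group C by fact
  have "f (a i) [^]\<^bsub>C\<^esub> expo i v = \<one>\<^bsub>C\<^esub>" if i: "i \<in> I" for i
  proof -
    have fa: "f (a i) \<in> carrier C" using i basis_closed hom_in_carrier[OF assms(2)] by auto
    obtain l where "expo i v = int N * l" using assms(6)[OF i] by (auto elim: dvdE)
    then have "f (a i) [^]\<^bsub>C\<^esub> expo i v = (f (a i) [^]\<^bsub>C\<^esub> N) [^]\<^bsub>C\<^esub> l"
      using fa by (simp add: C.int_pow_pow flip: int_pow_int)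
    then show ?thesis using C[OF fa] by simp
  qed
  then show ?thesis
    using hom_comm_group_eq_finprod[OF assms(1-4)] by (simp add: C.finprod_one_eqI)
qed

lemma h_inv_mult_gcd:
  fixes v :: 'a
  assumes "p > 1"
  defines "g \<equiv> Gcd (insert (int (p - 1)) ((\<lambda>i. expo i v) ` I))"
  shows "int (p - 1) = int (h_inv p F I a v) * g" and "g > 0"
proof -
  have d: "g dvd int (p - 1)" by (simp add: g_def)
  have "g \<noteq> 0" using assms(1) by (auto simp: g_def)
  moreover have "g \<ge> 0" by (simp add: g_def Gcd_int_greater_eq_0)
  ultimately show g: "g > 0" by simp
  have "int (nat g) = g" using g by simp
  moreover have "nat g dvd p - 1" using d g by (metis \<open>int (nat g) = g\<close> int_dvd_int_iff)
  ultimately show "int (p - 1) = int (h_inv p F I a v) * g"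
    unfolding h_inv_def g_def[symmetric] by (metis dvd_div_mult_self of_nat_mult)
qed

text \<open>The gcd in \<open>h_inv\<close> divides each \<open>expo i u\<close>, so
  \<open>p - 1\<close> divides all exponents of the \<open>h_inv\<close>-th power of
  \<open>u\<close>. This power therefore maps into the normal Sylow subgroup, where a power of
  \<open>p\<close> kills it.\<close>

lemma pseudovariety_hom_kills:
  assumes "p > 1" "finite I" "pseudovariety_V p H" "f \<in> hom F H" "u \<in> carrier F"
  obtains k where "f u [^]\<^bsub>H\<^esub> (h_inv p F I a u * p ^ k) = \<one>\<^bsub>H\<^esub>"
proof -
  let ?h = "h_inv p F I a u"
  obtain P k where P: "P \<lhd> H" "comm_group (H Mod P)"
    "\<And>C. C \<in> carrier (H Mod P) \<Longrightarrow> C [^]\<^bsub>H Mod P\<^esub> (p - 1) = \<one>\<^bsub>H Mod P\<^esub>"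
    "\<And>x. x \<in> P \<Longrightarrow> x [^]\<^bsub>H\<^esub> p ^ k = \<one>\<^bsub>H\<^esub>"
    using pseudovariety_exponent[OF assms(3)] by blast
  interpret N: normal P H by fact
  interpret f: group_hom F H f
    using assms(4) N.is_group by (simp add: group_hom_def group_hom_axioms_def is_group)
  have fh: "f u [^]\<^bsub>H\<^esub> ?h \<in> carrier H" using assms(5) by simp
  have "int (p - 1) dvd expo i (u [^] ?h)" if "i \<in> I" for i
  proof -
    have "expo i (u [^] ?h) = int ?h * expo i u"
      using expo_int_pow[OF assms(5), of i "int ?h"] by (simp add: int_pow_int)
    moreover have "Gcd (insert (int (p - 1)) ((\<lambda>i. expo i u) ` I)) dvd expo i u"
      using that by (intro Gcd_dvd) auto
    ultimately show ?thesis using h_inv_mult_gcd(1)[OF assms(1), of u] by (metis dvd_refl mult_dvd_mono)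
  qed
  then have "((\<lambda>x. P #>\<^bsub>H\<^esub> x) \<circ> f) (u [^] ?h) = \<one>\<^bsub>H Mod P\<^esub>"
    using assms(5) P(3)
    by (intro hom_comm_group_eq_one[OF assms(2) Group.hom_compose[OF assms(4) N.r_coset_hom_Mod] P(2)]) auto
  then have "P #>\<^bsub>H\<^esub> (f u [^]\<^bsub>H\<^esub> ?h) = P" using assms(5) f.hom_nat_pow by simp
  then have "f u [^]\<^bsub>H\<^esub> ?h \<in> P" using N.coset_join1[OF _ fh] N.subgroup_axioms by blast
  then have "(f u [^]\<^bsub>H\<^esub> ?h) [^]\<^bsub>H\<^esub> p ^ k = \<one>\<^bsub>H\<^esub>" by (rule P(4))
  then show ?thesis using that assms(5) by (simp add: N.nat_pow_pow)
qed

text \<open>By induction over the generation of the topology: on a subbasic set the period comes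
  from \<open>pseudovariety_hom_kills\<close>, and a union inherits it from one member. The value of
  \<open>k\<close> may depend on the set.\<close>

lemma open_set_periodic:
  assumes "p > 1" "finite I" "u \<in> carrier F" "openin (pro_topology (pseudovariety_V p) F) U"
  shows "u [^] (j::int) \<in> U \<Longrightarrow> \<exists>k. \<forall>s. u [^] (j + s * int (h_inv p F I a u * p ^ k)) \<in> U"
  using assms(4) unfolding pro_topology_def openin_topology_generated_by_iff
proof (induction rule: generate_topology_on.induct)
  case (Int A B)
  let ?h = "h_inv p F I a u"
  obtain k l where k: "\<And>s. u [^] (j + s * int (?h * p ^ k)) \<in> A"
    and l: "\<And>s. u [^] (j + s * int (?h * p ^ l)) \<in> B" using Int by blast
  \<comment> \<open>The new period is a common multiple of the two given ones.\<close>
  have "u [^] (j + s * int (?h * p ^ (k + l))) \<in> A \<inter> B" for s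
    using k[of "s * int (p ^ l)"] l[of "s * int (p ^ k)"] by (simp add: power_add mult_ac)
  then show ?case by blast
next
  case (Basis A)
  then obtain H :: "nat monoid" and f S where A: "A = {x \<in> carrier F. f x \<in> S}" and H: "pseudovariety_V p H" "f \<in> hom F H"
    by blast
  interpret f: group_hom F H f
    using H by (simp add: group_hom_def group_hom_axioms_def is_group pseudovariety_V_def)
  let ?h = "h_inv p F I a u"
  obtain k where k: "f u [^]\<^bsub>H\<^esub> (?h * p ^ k) = \<one>\<^bsub>H\<^esub>"
    using pseudovariety_hom_kills[OF assms(1,2) H assms(3)] .
  have "f (u [^] (j + s * int (?h * p ^ k))) = f (u [^] j)" for s
  proof -
    have "f u [^]\<^bsub>H\<^esub> (s * int (?h * p ^ k)) = (f u [^]\<^bsub>H\<^esub> (?h * p ^ k)) [^]\<^bsub>H\<^esub> s"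
      using assms(3) by (simp only: f.H.int_pow_pow f.hom_closed mult.commute flip: int_pow_int)
    then show ?thesis using assms(3) k by (simp add: f.hom_int_pow f.H.int_pow_mult)
  qed
  then show ?case using Basis.prems assms(3) by (intro exI[of _ k]) (auto simp: A)
qed blast+

text \<open>If \<open>w = v [^] r\<close>, then \<open>v\<close> commutes with \<open>w\<close>, so
  \<open>v = z [^] l\<close> with \<open>l * r = m\<close>. Hence \<open>r\<close> divides
  \<open>m\<close>, and \<open>r = m\<close> forces \<open>l = 1\<close>.\<close>

lemma exp_and_root:
  fixes m :: nat
  assumes "w = z [^] m" "m \<ge> 1" "z \<in> carrier F"
    and cent: "\<And>x. x \<in> carrier F \<Longrightarrow> x \<otimes> w = w \<otimes> x \<Longrightarrow> \<exists>l::int. x = z [^] l"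
    and inj: "\<And>i j::int. z [^] i = z [^] j \<Longrightarrow> i = j"
  shows "group_exp F w = m" and "group_root F w = z"
proof -
  have *: "\<exists>l. v = z [^] l \<and> l * int r = int m" if v: "v \<in> carrier F" "w = v [^] r" for v and r :: nat
  proof -
    have "v \<otimes> w = w \<otimes> v"
      using commutes_int_pow[OF v(1), of "int r"] v(2) by (simp add: int_pow_int)
    then obtain l where l: "v = z [^] (l::int)" using cent v(1) by blast
    have "z [^] (l * int r) = z [^] int m"
      using assms(1,3) v(2) by (simp add: l int_pow_int flip: int_pow_pow)
    then show ?thesis using inj l by blast
  qed
  show exp: "group_exp F w = m"
    unfolding group_exp_def
  proof (rule Greatest_equality)
    show "1 \<le> m \<and> (\<exists>v\<in>carrier F. w = v [^] m)" using assms by blast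
    fix r :: nat assume "1 \<le> r \<and> (\<exists>v\<in>carrier F. w = v [^] r)"
    then obtain l where "l * int r = int m" using * by blast
    then have "r dvd m" by (metis dvd_triv_right int_dvd_int_iff)
    then show "r \<le> m" using assms(2) by (auto dest: dvd_imp_le)
  qed
  show "group_root F w = z"
    unfolding group_root_def exp
  proof (rule the_equality)
    fix v assume "v \<in> carrier F \<and> w = v [^] m"
    then obtain l where l: "v = z [^] l" "l * int m = int m" using * by blast
    then show "v = z" using assms(2,3) by simp
  qed (use assms in simp)
qed

text \<open>A neighbourhood contains a whole progression of powers of \<open>u\<close> by
  \<open>open_set_periodic\<close>, and \<open>solve_linear_congruence\<close> finds in it an
  exponent divisible by \<open>e\<close>.\<close>

lemma root_power_in_closure:
  fixes p e :: nat and j :: int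
  assumes "Factorial_Ring.prime p" "finite I" "u \<in> carrier F" "e > 0"
  shows "u [^] (int (gcd e (h_inv p F I a u) * p ^ multiplicity p e) * j)
           \<in> pro_topology (pseudovariety_V p) F closure_of (range (\<lambda>t::int. (u [^] e) [^] t))"
    (is "u [^] (int ?d * j) \<in> ?T closure_of ?S")
proof -
  let ?h = "h_inv p F I a u"
  have p: "p > 1" using assms(1) prime_gt_1_nat by simp
  \<comment> \<open>The constant homomorphism to a trivial group makes the entire carrier open, so
    every power of \<open>u\<close> lies in the topological space.\<close>
  define H :: "nat monoid" where "H = \<lparr>carrier = {0}, monoid.mult = (\<lambda>x y. 0), one = 0\<rparr>"
  have "group H" by (rule groupI) (auto simp: H_def)
  then have "y [^]\<^bsub>H\<^esub> p ^ 0 = \<one>\<^bsub>H\<^esub>" if "y \<in> carrier H" for y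
    using monoid.nat_pow_closed[OF group.is_monoid that, of "p ^ 0"] by (simp add: H_def)
  then have "pseudovariety_V p H"
    by (rule group.finite_p_group_pseudovariety[OF \<open>group H\<close> assms(1), rotated]) (simp_all add: H_def)
  moreover have "(\<lambda>x. 0) \<in> hom F H" by (auto simp: hom_def H_def)
  ultimately have "openin ?T {x \<in> carrier F. 0 \<in> {0::nat}}"
    unfolding pro_topology_def
    by (intro topology_generated_by_Basis CollectI exI[of _ H] exI[of _ "\<lambda>x. 0"] exI[of _ "{0}"])
      (simp add: H_def)
  then have "u [^] (int ?d * j) \<in> topspace ?T"
    using openin_subset assms(3) by fastforce
  moreover have "\<exists>y. y \<in> ?S \<and> y \<in> U" if U: "u [^] (int ?d * j) \<in> U" "openin ?T U" for U
  proof -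
    obtain k where k: "\<And>s. u [^] (int ?d * j + s * int (?h * p ^ k)) \<in> U"
      using open_set_periodic[OF p assms(2,3) U(2,1)] by blast
    obtain s t where "int e * t = int ?d * j + s * int (?h * p ^ k)"
      using solve_linear_congruence[OF assms(1,4)] .
    then have "u [^] (int e * t) \<in> U" using k[of s] by simp
    moreover have "u [^] (int e * t) = (u [^] e) [^] t"
      using assms(3) by (simp add: int_pow_int flip: int_pow_pow)
    ultimately show ?thesis by auto
  qed
  ultimately show ?thesis by (auto simp: in_closure_of)
qed

text \<open>A cyclic quotient of order \<open>p - 1\<close> in which the image of \<open>u\<close> has order \<open>h_inv p F I a u\<close>.\<close>

lemma abelian_quotient:
  fixes p :: nat
  assumes "p > 1" "finite I" "u \<in> carrier F"
  obtains H :: "nat monoid" and f where "pseudovariety_V p H" "f \<in> hom F H"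
    "\<And>i j::int. f (u [^] i) = f (u [^] j) \<Longrightarrow> int (h_inv p F I a u) dvd i - j"
proof -
  define N where "N = p - 1"
  let ?h = "h_inv p F I a u"
  have N: "N > 0" using assms(1) by (simp add: N_def)
  define g where "g = Gcd (insert (int N) ((\<lambda>i. expo i u) ` I))"
  have g: "int N = int ?h * g" "g > 0"
    using h_inv_mult_gcd[OF assms(1), of u] by (simp_all add: g_def N_def)
  obtain c where c: "Gcd ((\<lambda>i. expo i u) ` I) = (\<Sum>i\<in>I. c i * expo i u)"
    using Gcd_eq_linear_combination[OF assms(2)] by blast
  obtain s t where "s * int N + t * Gcd ((\<lambda>i. expo i u) ` I) = gcd (int N) (Gcd ((\<lambda>i. expo i u) ` I))"
    using bezout_int by blast
  then have st: "g = s * int N + t * (\<Sum>i\<in>I. c i * expo i u)" by (simp add: g_def c)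
  \<comment> \<open>The Bezout combination makes \<open>\<psi> u\<close> congruent to
    \<open>g\<close> modulo \<open>N\<close>.\<close>
  define \<psi> where "\<psi> v = t * (\<Sum>i\<in>I. c i * expo i v)" for v
  have \<psi>_mult: "\<psi> (x \<otimes> y) = \<psi> x + \<psi> y" if "x \<in> carrier F" "y \<in> carrier F" for x y
    using that group_hom.hom_mult[OF expo_hom] by (simp add: \<psi>_def distrib_left sum.distrib)
  have \<psi>_pow: "\<psi> (u [^] i) = i * \<psi> u" for i :: int
    using expo_int_pow[OF assms(3)] by (simp add: \<psi>_def sum_distrib_left mult_ac)
  let ?Z = "integer_mod_group N"
  have car: "carrier ?Z = {0..<int N}" using N by (simp add: carrier_integer_mod_group)
  have "comm_group ?Z"
    by (rule group.group_comm_groupI) (simp_all add: add.commute)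
  have inj: "inj_on nat (carrier ?Z)" by (auto simp: car inj_on_def)
  \<comment> \<open>Transports the integers modulo \<open>N\<close> to a group on natural numbers,
    as \<open>pro_topology\<close> requires.\<close>
  define H where "H = image_group nat ?Z"
  have nat_iso: "nat \<in> iso ?Z H" unfolding H_def by (rule inj_imp_image_group_iso[OF inj])
  have "comm_group (H\<lparr>one := nat \<one>\<^bsub>?Z\<^esub>\<rparr>)"
    using comm_group.iso_imp_img_comm_group[OF \<open>comm_group ?Z\<close> nat_iso] .
  then have "comm_group H" by (simp add: H_def image_group_def)
  moreover have "order H = N"
    using card_image[OF inj] by (simp add: order_def H_def image_group_carrier car)
  ultimately have V: "pseudovariety_V p H"
    using comm_group.abelian_pseudovariety assms(1) N_def by blast
  have "(\<lambda>v. \<psi> v mod int N) \<in> hom F ?Z"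
    using N by (intro homI) (auto simp: car \<psi>_mult mod_simps)
  then have "nat \<circ> (\<lambda>v. \<psi> v mod int N) \<in> hom F H"
    using nat_iso by (intro Group.hom_compose) (auto simp: iso_def)
  moreover have "int ?h dvd i - j"
    if "(nat \<circ> (\<lambda>v. \<psi> v mod int N)) (u [^] i) = (nat \<circ> (\<lambda>v. \<psi> v mod int N)) (u [^] j)" for i j :: int
  proof -
    have "\<psi> (u [^] i) mod int N = \<psi> (u [^] j) mod int N"
      using that N eq_nat_nat_iff[of "\<psi> (u [^] i) mod int N" "\<psi> (u [^] j) mod int N"] by simp
    then have "int N dvd (i - j) * \<psi> u" by (simp add: \<psi>_pow mod_eq_dvd_iff left_diff_distrib)
    moreover have "g = s * int N + \<psi> u" by (simp add: st \<psi>_def)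
    \<comment> \<open>Both summands on the right are multiples of \<open>N = ?h * g\<close>; the
      positive factor \<open>g\<close> is cancelled afterwards.\<close>
    then have "(i - j) * g = int N * ((i - j) * s) + (i - j) * \<psi> u" by (simp add: algebra_simps)
    ultimately have "int ?h * g dvd (i - j) * g" unfolding g(1)[symmetric] by simp
    then show ?thesis using g(2) by simp
  qed
  ultimately show ?thesis using that V by blast
qed

text \<open>A nontrivial commutator of \<open>x\<close> and \<open>w\<close> would survive in a
  finite \<open>p\<close>-quotient, but there the image of \<open>x\<close> is a power of the image
  of \<open>w\<close>.\<close>

lemma commutes_if_in_closure:
  fixes p :: nat
  assumes "Factorial_Ring.prime p" "0 \<notin> I" "w \<in> carrier F" "x \<in> carrier F"
    and "x \<in> pro_topology (pseudovariety_V p) F closure_of (range (\<lambda>t::int. w [^] t))"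
  shows "x \<otimes> w = w \<otimes> x"
proof (rule ccontr)
  assume ne: "x \<otimes> w \<noteq> w \<otimes> x"
  define c where "c = x \<otimes> w \<otimes> inv (w \<otimes> x)"
  have c: "c \<in> carrier F" "c \<noteq> \<one>"
    using ne assms(3,4) inv_solve_right'[of "\<one>" "x \<otimes> w" "w \<otimes> x"] by (auto simp: c_def)
  obtain H :: "nat monoid" and f M where H: "group H" "finite (carrier H)"
    "\<And>y. y \<in> carrier H \<Longrightarrow> y [^]\<^bsub>H\<^esub> p ^ M = \<one>\<^bsub>H\<^esub>" "f \<in> hom F H" "f c \<noteq> \<one>\<^bsub>H\<^esub>"
    using residually_finite_p[OF prime_gt_1_nat[OF assms(1)] assms(2) c] by metis
  interpret f: group_hom F H f
    using H by (simp add: group_hom_def group_hom_axioms_def is_group)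
  have "pseudovariety_V p H" using f.H.finite_p_group_pseudovariety[OF assms(1) H(2,3)] .
  then have "f x \<in> f ` range (\<lambda>t::int. w [^] t)"
    using assms(3) H(4) by (intro separating_pro_topology[OF is_group assms(5)]) auto
  then obtain t :: int where "f x = f w [^]\<^bsub>H\<^esub> t" using assms(3) by (auto simp: f.hom_int_pow)
  then have "f x \<otimes>\<^bsub>H\<^esub> f w = f w \<otimes>\<^bsub>H\<^esub> f x"
    using f.H.commutes_int_pow[of "f w" t] assms(3) by simp
  then have "f c = \<one>\<^bsub>H\<^esub>" using assms(3,4) by (simp add: c_def)
  then show False using H(5) by simp
qed

text \<open>In the cyclic quotient \<open>u [^] j\<close> agrees with some
  \<open>u [^] (e t)\<close>, so \<open>h_inv\<close> divides \<open>j - e t\<close>; the gcd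
  divides this and \<open>e\<close>.\<close>

lemma gcd_h_inv_dvd:
  fixes p :: nat
  assumes "p > 1" "finite I" "u \<in> carrier F"
    and "u [^] (j::int) \<in> pro_topology (pseudovariety_V p) F closure_of (range (\<lambda>t::int. u [^] (int e * t)))"
  shows "int (gcd e (h_inv p F I a u)) dvd j"
proof -
  obtain H :: "nat monoid" and f where H: "pseudovariety_V p H" "f \<in> hom F H"
    "\<And>i j::int. f (u [^] i) = f (u [^] j) \<Longrightarrow> int (h_inv p F I a u) dvd i - j"
    using abelian_quotient[OF assms(1-3)] by metis
  have "f (u [^] j) \<in> f ` range (\<lambda>t::int. u [^] (int e * t))"
    using assms(3) by (intro separating_pro_topology[OF is_group assms(4) _ H(1,2)]) auto
  then obtain t where "int (h_inv p F I a u) dvd j - int e * t" using H(3) by blast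
  then have "int (gcd e (h_inv p F I a u)) dvd (j - int e * t) + int e * t"
    by (intro dvd_add dvd_mult2) (auto intro: dvd_trans[OF _ \<open>_ dvd j - _\<close>])
  then show ?thesis by simp
qed

text \<open>If \<open>p ^ Suc i\<close> is the \<open>p\<close>-part of \<open>e\<close>, a finite
  \<open>p\<close>-quotient in which \<open>u [^] p ^ i\<close> survives gives \<open>u\<close> an
  order divisible by \<open>p ^ Suc i\<close>. This order divides some \<open>j - e t\<close>, and
  \<open>p ^ Suc i\<close> divides \<open>e\<close>.\<close>

lemma nu_dvd:
  fixes p e :: nat
  assumes "Factorial_Ring.prime p" "0 \<notin> I" "u \<in> carrier F" "\<And>i::nat. u [^] i = \<one> \<Longrightarrow> i = 0"
    and "u [^] (j::int) \<in> pro_topology (pseudovariety_V p) F closure_of (range (\<lambda>t::int. u [^] (int e * t)))"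
  shows "int (p ^ multiplicity p e) dvd j"
proof (cases "multiplicity p e")
  case (Suc i)
  have "u [^] p ^ i \<noteq> \<one>" using assms(4)[of "p ^ i"] assms(1) by auto
  then obtain H :: "nat monoid" and f M where H: "group H" "finite (carrier H)"
    "\<And>y. y \<in> carrier H \<Longrightarrow> y [^]\<^bsub>H\<^esub> p ^ M = \<one>\<^bsub>H\<^esub>" "f \<in> hom F H" "f (u [^] p ^ i) \<noteq> \<one>\<^bsub>H\<^esub>"
    using residually_finite_p[OF prime_gt_1_nat[OF assms(1)] assms(2) nat_pow_closed[OF assms(3)], of "p ^ i"]
    by metis
  interpret f: group_hom F H f
    using H by (simp add: group_hom_def group_hom_axioms_def is_group)
  have fu: "f u \<in> carrier H" using assms(3) by simp
  have "pseudovariety_V p H" using f.H.finite_p_group_pseudovariety[OF assms(1) H(2,3)] .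
  then have "f (u [^] j) \<in> f ` range (\<lambda>t::int. u [^] (int e * t))"
    using assms(3) H(4) by (intro separating_pro_topology[OF is_group assms(5)]) auto
  then obtain t where "f u [^]\<^bsub>H\<^esub> j = f u [^]\<^bsub>H\<^esub> (int e * t)"
    using assms(3) by (auto simp: f.hom_int_pow)
  then have "f u [^]\<^bsub>H\<^esub> (j - int e * t) = \<one>\<^bsub>H\<^esub>" using fu by (simp add: f.H.int_pow_diff)
  moreover have "f u [^]\<^bsub>H\<^esub> p ^ i \<noteq> \<one>\<^bsub>H\<^esub>" using H(5) assms(3) by (simp add: f.hom_nat_pow)
  ultimately have "int (p ^ multiplicity p e) dvd j - int e * t"
    unfolding Suc using f.H.prime_power_dvd_exponent[OF assms(1) fu H(3)[OF fu]] by blast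
  moreover have "int (p ^ multiplicity p e) dvd int e * t"
    using multiplicity_dvd[of p e] by (metis dvd_mult2 int_dvd_int_iff)
  ultimately show ?thesis by (metis diff_add_cancel dvd_add)
qed simp

end

theorem corollary4p7:
  fixes p n :: nat and F :: "('g, 'm) monoid_scheme" and a :: "nat \<Rightarrow> 'g"
    and w u :: 'g and e d :: nat
  assumes "Factorial_Ring.prime p"
    and "free_basis F {1..n} a"
    and "w \<in> carrier F" and "w \<noteq> \<one>\<^bsub>F\<^esub>"
    and "u = group_root F w" and "e = group_exp F w"
    and "d = gcd e (h_inv p F {1..n} a u) * nu p e"
  shows "pro_topology (pseudovariety_V p) F closure_of generate F {w}
           = generate F {u [^]\<^bsub>F\<^esub> d}"
proof -
  interpret free_group F "{1..n}" a
    using assms(2) by (simp add: free_group_def free_group_axioms_def free_basis_def)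
  let ?h = "h_inv p F {1..n} a u" and ?T = "pro_topology (pseudovariety_V p) F"
  have p: "p > 1" using prime_gt_1_nat[OF assms(1)] .
  obtain z and m :: nat where z: "z \<in> carrier F" "m \<ge> 1" "w = z [^]\<^bsub>F\<^esub> m"
    and cent: "\<And>x. x \<in> carrier F \<Longrightarrow> x \<otimes>\<^bsub>F\<^esub> w = w \<otimes>\<^bsub>F\<^esub> x \<Longrightarrow> \<exists>l::int. x = z [^]\<^bsub>F\<^esub> l"
    and inj: "\<And>i j::int. z [^]\<^bsub>F\<^esub> i = z [^]\<^bsub>F\<^esub> j \<Longrightarrow> i = j"
    using centralizer_cyclic[OF assms(3,4)] by metis
  have em: "e = m" and uz: "u = z"
    using exp_and_root[OF z(3,2,1) cent inj] assms(5,6) by blast+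
  note u = z(1)[folded uz] and e = z(2)[folded em] and w = z(3)[folded uz em]
    and cent = cent[folded uz] and inj = inj[folded uz]
  have gen_w: "generate F {w} = range (\<lambda>t::int. w [^]\<^bsub>F\<^esub> t)"
    using generate_pow[OF assms(3)] by auto
  have w_pow: "range (\<lambda>t::int. w [^]\<^bsub>F\<^esub> t) = range (\<lambda>t::int. u [^]\<^bsub>F\<^esub> (int e * t))"
    using u by (simp add: w int_pow_int flip: int_pow_pow)
  have ud: "(u [^]\<^bsub>F\<^esub> d) [^]\<^bsub>F\<^esub> j = u [^]\<^bsub>F\<^esub> (int d * j)" for j :: int
    using u by (simp add: int_pow_int flip: int_pow_pow)
  have d: "d = gcd e ?h * p ^ multiplicity p e" using assms(7) by (simp add: nu_def)
  show ?thesis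
  proof (intro equalityI subsetI)
    fix x assume "x \<in> generate F {u [^]\<^bsub>F\<^esub> d}"
    then obtain j :: int where "x = u [^]\<^bsub>F\<^esub> (int d * j)"
      using generate_pow[OF nat_pow_closed[OF u]] ud by auto
    then show "x \<in> ?T closure_of generate F {w}"
      using root_power_in_closure[OF assms(1) _ u, of e j, folded d w] e by (simp add: gen_w)
  next
    fix x assume "x \<in> ?T closure_of generate F {w}"
    then have x: "x \<in> ?T closure_of (range (\<lambda>t::int. w [^]\<^bsub>F\<^esub> t))" by (simp only: gen_w)
    then have "x \<in> topspace ?T" by (simp add: in_closure_of)
    then have xF: "x \<in> carrier F" by (auto simp: pro_topology_def)
    \<comment> \<open>Indices start at 1, which supplies \<open>0 \<notin> I\<close> for
      ping-pong.\<close>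
    have "x \<otimes>\<^bsub>F\<^esub> w = w \<otimes>\<^bsub>F\<^esub> x"
      using commutes_if_in_closure[OF assms(1) _ assms(3) xF x] by simp
    then obtain j :: int where j: "x = u [^]\<^bsub>F\<^esub> j" using cent xF by blast
    note uj = x[unfolded w_pow j]
    have "int (gcd e ?h) dvd j" using gcd_h_inv_dvd[OF p _ u uj] by simp
    moreover have "int (p ^ multiplicity p e) dvd j"
      using nu_dvd[OF assms(1) _ u _ uj] inj[of "int _" 0] by (simp add: int_pow_int)
    \<comment> \<open>The first factor divides \<open>p - 1\<close>, so it is prime to
      \<open>p\<close>, and the two divisibilities combine to \<open>d\<close> dividing
      \<open>j\<close>.\<close>
    moreover have "coprime (gcd e ?h) (p ^ multiplicity p e)"
    proof -
      have "int ?h dvd int (p - 1)" using h_inv_mult_gcd(1)[OF p, of u] by (metis dvd_triv_left)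
      then have "gcd e ?h dvd p - 1" by (meson dvd_trans gcd_dvd2 int_dvd_int_iff)
      moreover have "coprime (p - 1) p" using p coprime_diff_one_left_nat by simp
      ultimately show ?thesis by (meson coprime_divisors coprime_power_right_iff dvd_refl)
    qed
    ultimately have "int d dvd j" unfolding d of_nat_mult by (intro divides_mult) simp_all
    then obtain l where "j = int d * l" by (elim dvdE)
    then have "x = (u [^]\<^bsub>F\<^esub> d) [^]\<^bsub>F\<^esub> l" using ud j by simp
    then show "x \<in> generate F {u [^]\<^bsub>F\<^esub> d}" using generate_pow[OF nat_pow_closed[OF u]] by auto
  qed
qed

end
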